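(* Assume that for every integer $k'\ge1$ and every positive integer $m$ with $\gcd(k',m)=1$ one has $G_m^{(k')}=G_m^{(1)}$. Let $k=p^a$ be a prime power ($p$ prime, $a\ge1$). Then $L_{D_k}(t)=Q(t^{p})\,L_{D_1}(t)$ for some polynomial $Q(t)\in\mathbb{Z}[t]$.
   Context: For $k\ge1$, $D_k$ is the smooth projective (absolutely irreducible) curve over $\mathbb{F}_2$ birational to the affine curve $y^2+y=x^{2^k+1}+x^{-1}$, and $L_{D_k}(t)\in\mathbb{Z}[t]$ is its L-polynomial over $\mathbb{F}_2$, defined by $\exp\left(\sum_{n\ge1}\#D_k(\mathbb{F}_{2^n})\frac{t^n}{n}\right)=\frac{L_{D_k}(t)}{(1-t)(1-2t)}$. For $m\ge1$, $G_m^{(k)}=\sum_{x\in\mathbb{F}_{2^m}^*}(-1)^{\mathrm{Tr}_m(x^{2^k+1}+x^{-1})}$, where $\mathrm{Tr}_m$ is the trace from $\mathbb{F}_{2^m}$ to $\mathbb{F}_2$. *)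

theory Defs
  imports
    "HOL-Algebra.Generated_Fields"
    "HOL-Algebra.Algebraic_Closure_Type"
    "HOL-Computational_Algebra.Polynomial_FPS"
    "HOL-Library.Z2"
begin

text \<open>
  All fields live inside one algebraically closed field, an algebraic closure
  of the rational function field \<open>F\<^sub>2(x)\<close> (the type \<open>bit\<close> is the two-element field).
  It contains an algebraic closure of \<open>F\<^sub>2\<close>, hence exactly one copy of each \<open>F\<^bsub>2^n\<^esub>\<close>, \<open>n \<ge> 1\<close>.
\<close>

type_synonym ambient = "bit poly fract alg_closure"

abbreviation ambient_ring :: "ambient ring" where
  "ambient_ring \<equiv> ring_of_type_algebra"

definition F2pow :: "nat \<Rightarrow> ambient set" where
  "F2pow n = {c. c ^ (2 ^ n) = c}"


subsection \<open>The exponential sums\<close>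

text \<open>
  The trace from \<open>F\<^bsub>2^m\<^esub>\<close> to \<open>F\<^sub>2\<close> as the sum of the conjugates; its values \<open>0, 1\<close> are
  elements of the ambient field, so \<open>(-1)\<^bsup>Tr\<^esup>\<close> is spelled out by cases.
\<close>

definition trace2 :: "nat \<Rightarrow> ambient \<Rightarrow> ambient" where
  "trace2 m u = (\<Sum>i<m. u ^ (2 ^ i))"

definition G :: "nat \<Rightarrow> nat \<Rightarrow> int" where
  "G k m = (\<Sum>u \<in> F2pow m - {0}.
     if trace2 m (u ^ (2 ^ k + 1) + inverse u) = 0 then 1 else -1)"


subsection \<open>Rational places of a function field\<close>

text \<open>
  For a function field \<open>K\<close> of one variable over \<open>F\<close>, the closed points of the smooth projective
  curve over \<open>F\<close> with function field \<open>K\<close> are the valuation rings of \<open>K/F\<close> (the local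
  rings of the curve), and its \<open>F\<close>-rational points are those with residue field \<open>F\<close>.
\<close>

definition valuation_ring :: "ambient set \<Rightarrow> ambient set \<Rightarrow> ambient set \<Rightarrow> bool" where
  "valuation_ring F K V \<longleftrightarrow>
     subring V ambient_ring \<and> F \<subset> V \<and> V \<subset> K \<and> (\<forall>u\<in>K. u \<in> V \<or> inverse u \<in> V)"

definition maximal_ideal_of :: "ambient set \<Rightarrow> ambient set" where
  "maximal_ideal_of V = {u \<in> V. u = 0 \<or> inverse u \<notin> V}"

definition rational_places :: "ambient set \<Rightarrow> ambient set \<Rightarrow> ambient set set" where
  "rational_places F K =
     {V. valuation_ring F K V \<and> (\<forall>u\<in>V. \<exists>c\<in>F. u - c \<in> maximal_ideal_of V)}"


subsection \<open>The curves \<open>D\<^sub>k\<close>\<close>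

definition x_D :: ambient where
  "x_D = to_ac (Fract [:0, 1:] 1)"

text \<open>The other root of the quadratic equation is \<open>y + 1\<close>, so the choice does not affect the
  function fields below.\<close>

definition y_D :: "nat \<Rightarrow> ambient" where
  "y_D k = (SOME y. y ^ 2 + y = x_D ^ (2 ^ k + 1) + inverse x_D)"

lemma y_D_eq: "y_D k ^ 2 + y_D k = x_D ^ (2 ^ k + 1) + inverse x_D"
proof -
  define c where "c = x_D ^ (2 ^ k + 1) + inverse x_D"
  have "\<exists>y. poly [:- c, 1, 1:] y = 0"
    by (rule alg_closed_imp_poly_has_root) simp
  then obtain y where "y ^ 2 + y = c"
    by (auto simp: algebra_simps power2_eq_square)
  thus ?thesis
    unfolding y_D_def c_def by (rule someI[where P = "\<lambda>y. y ^ 2 + y = c" for c])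
qed

text \<open>
  Since \<open>D\<^sub>k\<close> is absolutely irreducible, its base change to \<open>F\<^bsub>2^n\<^esub>\<close> is the smooth projective
  curve with function field \<open>F\<^bsub>2^n\<^esub>(x, y)\<close>.
\<close>

definition function_field_D :: "nat \<Rightarrow> nat \<Rightarrow> ambient set" where
  "function_field_D k n = generate_field ambient_ring (F2pow n \<union> {x_D, y_D k})"

definition points_D :: "nat \<Rightarrow> nat \<Rightarrow> ambient set set" where
  "points_D k n = rational_places (F2pow n) (function_field_D k n)"


subsection \<open>L-polynomials\<close>

definition zeta_fps :: "(nat \<Rightarrow> nat) \<Rightarrow> rat fps" where
  "zeta_fps N = fps_compose (fps_exp 1)
     (Abs_fps (\<lambda>n. if n = 0 then 0 else of_nat (N n) / of_nat n))"

definition is_L_polynomial :: "nat \<Rightarrow> int poly \<Rightarrow> bool" where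
  "is_L_polynomial k L \<longleftrightarrow>
     zeta_fps (\<lambda>n. card (points_D k n)) =
       fps_of_poly (map_poly of_int L) / ((1 - fps_X) * (1 - 2 * fps_X))"

definition L_D :: "nat \<Rightarrow> int poly" where
  "L_D k = (THE L. is_L_polynomial k L)"

lemma L_D_eqI:
  assumes "is_L_polynomial k L"
  shows "L_D k = L"
  unfolding L_D_def
proof (rule the_equality[where P = "is_L_polynomial k", OF assms])
  fix M assume "is_L_polynomial k M"
  define d :: "rat fps" where "d = (1 - fps_X) * (1 - 2 * fps_X)"
  have "fps_nth d 0 \<noteq> 0" by (simp add: d_def)
  hence d: "is_unit d" by simp
  have "fps_of_poly (map_poly rat_of_int M) / d = fps_of_poly (map_poly rat_of_int L) / d"
    using assms \<open>is_L_polynomial k M\<close> by (simp add: is_L_polynomial_def d_def)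
  hence "fps_of_poly (map_poly rat_of_int M) = fps_of_poly (map_poly rat_of_int L)"
    using d by (metis dvd_div_mult_self unit_imp_dvd)
  hence "map_poly rat_of_int M = map_poly rat_of_int L" by simp
  thus "M = L"
    by (auto simp: poly_eq_iff coeff_map_poly)
qed

end

(*
  Counting the solutions of the Artin-Schreier equation by traces gives
  #D_k(F_{2^n}) = 2^n + 1 + G_n^(k), since every affine point is smooth in the coordinates (x, xy) and
  there is one further place over x = infinity. Hence L_{D_k}(t) = exp (sum_n G_n^(k) t^n / n), and
  unique factorisation over F_2 turns this into the sum of chi(h) t^(deg h) over the monic h in F_2[X]
  with h(0) <> 0, where chi(h) = (-1)^(sum of z^(2^k+1) + 1/z over the roots z of h). By Newton's
  identities chi sums to 0 in all degrees above 2^k + 2, so L_{D_k} is a polynomial, and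
  L_{D_1} = 1 + t + 2 t^3 + 4 t^4.

  The logarithmic derivative of R = L_{D_k} / L_{D_1} only involves G_n^(k) - G_n^(1), which vanishes
  unless p divides n, so R is a power series in t^p. Comparing the coefficients of
  (1 + t + 2 t^3 + 4 t^4) R = L_{D_k} in the residue classes modulo p shows that R is a polynomial.
*)

theory Submission
  imports Defs
begin

text \<open>Points are valuation rings of a field that is only known as a set inside the ambient
  field, so counting points means classifying places. The two charts \<open>(x, x y)\<close> and
  \<open>(1/x, y / x^(M+1))\<close> with \<open>M = 2^(k-1)\<close> both satisfy an equation
  \<open>w^2 + s^m w = s + s^(r+1)\<close>. Such a curve is smooth and has a single point over
  \<open>s = 0\<close>, so one argument yields the finite places as well as the place at infinity.
  The Euler product is never formed. Irreducible polynomials and their powers are replaced by pairs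
  of an \<open>n\<close> and an element of \<open>F2pow n\<close>, whose \<open>n\<close> conjugates
  are the roots of a power of its minimal polynomial; these pairs are exactly what the sums
  \<open>G\<close> run over. The hypothesis says nothing about \<open>G k n\<close> when
  \<open>p\<close> divides \<open>n\<close>, so it only controls which exponents occur in the
  quotient of the two L-polynomials. That the quotient is a polynomial rests on the explicit
  L-polynomial of the first curve: the gaps between its exponents 0, 1, 3, 4 leave recurrences with
  only the trivial solution, \<open>p = 2\<close> and \<open>p = 3\<close> being the tight
  cases.\<close>

lemma proots_prod_linear: "proots (\<Prod>x\<in>#A. [:- x, 1:]) = (A :: 'a :: idom multiset)"
proof (induction A)
  case (add x A)
  have "(\<Prod>x\<in>#A. [:- x, 1:]) \<noteq> 0" by (auto simp: prod_mset_zero_iff)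
  thus ?case using add by (simp add: proots_mult proots_linear_factor[of "- x", simplified] del: mult_pCons_left)
qed simp

lemma alg_closed_factorization:
  fixes P :: "'a :: alg_closed_field poly"
  assumes "P \<noteq> 0"
  shows "Polynomial.smult (Polynomial.lead_coeff P) (\<Prod>x\<in>#proots P. [:- x, 1:]) = P"
    and "size (proots P) = Polynomial.degree P"
proof -
  obtain A where A: "size A = Polynomial.degree P"
      "P = Polynomial.smult (Polynomial.lead_coeff P) (\<Prod>x\<in>#A. [:- x, 1:])"
    using alg_closed_imp_factorization[OF assms] by blast
  have "proots P = proots (\<Prod>x\<in>#A. [:- x, 1:])"
    by (subst A(2), rule proots_smult) (use assms in auto)
  hence "proots P = A" by (simp add: proots_prod_linear)
  with A show "Polynomial.smult (Polynomial.lead_coeff P) (\<Prod>x\<in>#proots P. [:- x, 1:]) = P"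
    and "size (proots P) = Polynomial.degree P" by auto
qed

section \<open>Characteristic two and the fields \<open>F2pow n\<close>\<close>

lemma ambient_two [simp]: "(2 :: ambient) = 0"
proof -
  have "(2 :: bit poly) = [:1 + 1:]" by (simp add: numeral_poly)
  hence "(2 :: bit poly) = 0" by simp
  hence "(2 :: bit poly fract) = 0"
    by (metis Fract_of_int_quotient Zero_fract_def fract_collapse(1) of_int_numeral of_nat_numeral
          Fract_of_nat_eq rat_number_collapse)
  hence "to_ac (2 :: bit poly fract) = 0" by simp
  thus ?thesis by simp
qed

lemma fract_char [simp]: "CHAR(bit poly fract) = 2"
proof -
  have "of_nat 2 = (0 :: ambient)" by simp
  hence "CHAR(ambient) dvd 2" by (simp only: of_nat_eq_0_iff_char_dvd)
  moreover have "CHAR(ambient) \<noteq> 1" by simp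
  ultimately have "CHAR(ambient) = 2" using prime_nat_iff two_is_prime_nat by blast
  thus ?thesis by simp
qed

lemma ambient_add_self [simp]: "(a :: ambient) + a = 0"
  by (metis ambient_two mult_2 mult_zero_left)

text \<open>As simp rules, this and \<open>ambient_diff\<close> remove every sign, so that later on
  the factors \<open>[:- x, 1:]\<close> and \<open>[:x, 1:]\<close> of ambient polynomials are the
  same.\<close>

lemma ambient_uminus [simp]: "- (a :: ambient) = a"
  using ambient_add_self[of a] by (simp only: add_eq_0_iff)

lemma ambient_diff [simp]: "(a :: ambient) - b = a + b"
  using diff_conv_add_uminus[of a b] by simp

lemma ambient_add_cancel [simp]: "(a :: ambient) + (a + b) = b"
  by (simp flip: add.assoc)

lemma ambient_add_eq_0_iff: "(a :: ambient) + b = 0 \<longleftrightarrow> a = b"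
  by (metis add_eq_0_iff2 ambient_uminus)

lemma frobenius_add: "((a :: ambient) + b) ^ (2 ^ n) = a ^ (2 ^ n) + b ^ (2 ^ n)"
  by (rule freshmans_dream') auto

lemma frobenius_sum: "(\<Sum>i\<in>I. f i :: ambient) ^ (2 ^ n) = (\<Sum>i\<in>I. f i ^ (2 ^ n))"
  by (rule freshmans_dream_sum') auto

lemma frobenius_eq_iff: "(a :: ambient) ^ (2 ^ n) = b ^ (2 ^ n) \<longleftrightarrow> a = b"
proof
  assume "a ^ (2 ^ n) = b ^ (2 ^ n)"
  hence "(a + b) ^ (2 ^ n) = 0" by (simp add: frobenius_add)
  hence "a + b = 0" by simp
  thus "a = b" by (metis add_eq_0_iff ambient_uminus)
qed simp

lemma F2pow_0 [simp]: "0 \<in> F2pow n" and F2pow_1 [simp]: "1 \<in> F2pow n"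
  by (auto simp: F2pow_def)

lemma F2pow_add: "a \<in> F2pow n \<Longrightarrow> b \<in> F2pow n \<Longrightarrow> a + b \<in> F2pow n"
  by (simp add: F2pow_def frobenius_add)

lemma F2pow_mult: "a \<in> F2pow n \<Longrightarrow> b \<in> F2pow n \<Longrightarrow> a * b \<in> F2pow n"
  by (simp add: F2pow_def power_mult_distrib)

lemma F2pow_inverse: "a \<in> F2pow n \<Longrightarrow> inverse a \<in> F2pow n"
  by (simp add: F2pow_def power_inverse)

lemma F2pow_power: "a \<in> F2pow n \<Longrightarrow> a ^ i \<in> F2pow n"
  by (induction i) (auto intro: F2pow_mult)

lemma F2pow_sum: "(\<And>i. i \<in> I \<Longrightarrow> f i \<in> F2pow n) \<Longrightarrow> sum f I \<in> F2pow n"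
  by (induction I rule: infinite_finite_induct) (auto intro: F2pow_add)

lemma F2pow_Suc_0: "F2pow (Suc 0) = {0, 1}"
proof -
  have "c ^ 2 = c \<longleftrightarrow> c = 0 \<or> c = 1" for c :: ambient
    by (metis mult_cancel_right1 power2_eq_square mult_zero_left)
  thus ?thesis by (auto simp: F2pow_def)
qed

text \<open>The elements are the roots of \<open>X^(2^n) + X\<close>. Its derivative is 1 because
  \<open>2^n\<close> is even for positive \<open>n\<close>, so all roots are simple and their number
  is the degree.\<close>

lemma finite_F2pow: "n > 0 \<Longrightarrow> finite (F2pow n)"
  and card_F2pow: "n > 0 \<Longrightarrow> card (F2pow n) = 2 ^ n"
proof -
  assume n: "n > 0"
  define P :: "ambient poly" where "P = Polynomial.monom 1 (2 ^ n) + [:0, 1:]"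
  have two: "(2::nat) ^ n > 1" using n by (intro one_less_power) auto
  have deg: "Polynomial.degree P = 2 ^ n"
    unfolding P_def by (subst degree_add_eq_left) (use two in \<open>auto simp: degree_monom_eq simp del: One_nat_def\<close>)
  have P0: "P \<noteq> 0" using deg by auto
  have roots: "{x. poly P x = 0} = F2pow n"
    by (auto simp: P_def F2pow_def poly_monom add_eq_0_iff)
  show "finite (F2pow n)" using poly_roots_finite[OF P0] roots by simp
  have pd: "pderiv P = 1"
    using n by (simp add: P_def pderiv_add pderiv_monom pderiv_pCons one_pCons)
  have cnt: "count (proots P) x = 1" if "poly P x = 0" for x
  proof -
    obtain Q where Q: "P = [:- x, 1:] * Q"
      using \<open>poly P x = 0\<close> unfolding poly_eq_0_iff_dvd dvd_def by blast
    have "poly (pderiv P) x = poly Q x"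
      unfolding Q pderiv_mult by (simp add: pderiv_pCons)
    hence "poly Q x \<noteq> 0" using pd by simp
    moreover have "Q \<noteq> 0" using Q P0 by auto
    ultimately show ?thesis
      unfolding Q by (subst proots_mult) (auto simp: proots_linear_factor[of "- x", simplified] order_0I)
  qed
  have "size (proots P) = 2 ^ n"
    using alg_closed_factorization(2)[OF P0] deg by simp
  thus "card (F2pow n) = 2 ^ n"
    unfolding roots[symmetric] using set_count_proots[OF P0] cnt
    by (simp add: size_multiset_overloaded_eq)
qed

section \<open>Polynomials over the prime field\<close>

text \<open>\<open>F\<^sub>2[X]\<close> is encoded as the set of ambient polynomials fixed by this
  map, which keeps polynomials over the prime field and their roots in one type.\<close>

definition frob_poly :: "ambient poly \<Rightarrow> ambient poly" where
  "frob_poly h = map_poly (\<lambda>c. c ^ 2) h"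

lemma coeff_frob_poly: "poly.coeff (frob_poly h) i = poly.coeff h i ^ 2"
  by (simp add: frob_poly_def coeff_map_poly)

lemma frob_poly_mult: "frob_poly (g * h) = frob_poly g * frob_poly h"
proof (rule poly_eqI)
  fix i
  show "poly.coeff (frob_poly (g * h)) i = poly.coeff (frob_poly g * frob_poly h) i"
    unfolding coeff_frob_poly coeff_mult frobenius_sum[where n = 1, unfolded power_one_right]
      power_mult_distrib ..
qed

lemma frob_poly_add: "frob_poly (g + h) = frob_poly g + frob_poly h"
  by (rule poly_eqI) (use frobenius_add[where n = 1] in \<open>simp add: coeff_frob_poly\<close>)

lemma frob_poly_pCons: "frob_poly (pCons a h) = pCons (a ^ 2) (frob_poly h)"
  by (simp add: frob_poly_def map_poly_pCons)

lemma frob_poly_0 [simp]: "frob_poly 0 = 0" and frob_poly_1 [simp]: "frob_poly 1 = 1"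
  by (simp_all add: frob_poly_def)

lemma frob_poly_prod: "frob_poly (prod f I) = (\<Prod>i\<in>I. frob_poly (f i))"
  by (induction I rule: infinite_finite_induct) (auto simp: frob_poly_mult)

lemma frob_poly_fixed_iff: "frob_poly h = h \<longleftrightarrow> (\<forall>i. poly.coeff h i \<in> {0, 1})"
proof -
  have "frob_poly h = h \<longleftrightarrow> (\<forall>i. poly.coeff h i \<in> F2pow (Suc 0))"
    by (auto simp: poly_eq_iff coeff_frob_poly F2pow_def)
  thus ?thesis by (simp add: F2pow_Suc_0)
qed

lemma poly_frob_poly: "poly (frob_poly h) (x ^ 2) = poly h x ^ 2"
proof (induction h)
  case (pCons a h)
  thus ?case using frobenius_add[where n = 1]
    by (simp add: frob_poly_pCons power_mult_distrib)
qed auto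

lemma root_frobenius_orbit:
  assumes "frob_poly h = h" "poly h x = 0"
  shows "poly h (x ^ (2 ^ i)) = 0"
proof (induction i)
  case (Suc i)
  have "x ^ (2 ^ Suc i) = (x ^ (2 ^ i)) ^ 2"
    by (metis power_Suc2 power_mult)
  thus ?case using poly_frob_poly[of h "x ^ (2 ^ i)"] assms Suc by simp
qed (use assms in auto)

text \<open>Over the prime field a nonzero constant term equals 1. These are the monic polynomials
  prime to \<open>X\<close>, for which the inverses of the roots exist.\<close>

definition monic_F2 :: "nat \<Rightarrow> ambient poly set" where
  "monic_F2 d = {h. Polynomial.degree h = d \<and> poly.coeff h 0 = 1 \<and> poly.coeff h d = 1 \<and> frob_poly h = h}"

lemma monic_F2_nonzero: "h \<in> monic_F2 d \<Longrightarrow> h \<noteq> 0"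
  by (auto simp: monic_F2_def)

lemma finite_monic_F2: "finite (monic_F2 d)"
proof -
  have "monic_F2 d \<subseteq> Poly ` {xs. set xs \<subseteq> {0, 1} \<and> length xs = Suc d}"
  proof
    fix h assume h: "h \<in> monic_F2 d"
    have "h = Poly (coeffs h)" by simp
    moreover have "length (coeffs h) = Suc d"
      using h monic_F2_nonzero[OF h] by (simp add: length_coeffs monic_F2_def)
    moreover have "set (coeffs h) \<subseteq> {0, 1}"
    proof
      fix c assume "c \<in> set (coeffs h)"
      then obtain i where "c = poly.coeff h i"
        by (metis coeffs_nth in_set_conv_nth length_coeffs_degree length_pos_if_in_set less_Suc_eq_le list.size(3) coeffs_eq_Nil neq0_conv)
      thus "c \<in> {0, 1}" using h frob_poly_fixed_iff by (auto simp: monic_F2_def)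
    qed
    ultimately show "h \<in> Poly ` {xs. set xs \<subseteq> {0, 1} \<and> length xs = Suc d}" by blast
  qed
  thus ?thesis by (rule finite_subset) (intro finite_imageI finite_lists_length_eq, simp)
qed

lemma monic_F2_mult: "g \<in> monic_F2 m \<Longrightarrow> h \<in> monic_F2 n \<Longrightarrow> g * h \<in> monic_F2 (m + n)"
  by (auto simp: monic_F2_def frob_poly_mult coeff_mult_0 degree_mult_eq coeff_mult_degree_sum monic_F2_nonzero)

text \<open>Both \<open>g\<close> and \<open>g * h\<close> are fixed by \<open>frob_poly\<close>, so
  cancelling \<open>g\<close> in \<open>g * frob_poly h = g * h\<close> puts the cofactor into
  \<open>F\<^sub>2[X]\<close>.\<close>

lemma monic_F2_divide:
  assumes "g * h \<in> monic_F2 d" "g \<in> monic_F2 m"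
  shows "m \<le> d" "h \<in> monic_F2 (d - m)"
proof -
  have nz: "g \<noteq> 0" "h \<noteq> 0" using monic_F2_nonzero[OF assms(1)] by auto
  have d: "d = m + Polynomial.degree h"
    using assms degree_mult_eq[OF nz] by (simp add: monic_F2_def)
  show "m \<le> d" using d by simp
  have "g * frob_poly h = g * h"
    using assms by (simp add: monic_F2_def frob_poly_mult)
  hence "frob_poly h = h" using nz by simp
  moreover have "poly.coeff h (Polynomial.degree h) = 1"
    using assms coeff_mult_degree_sum[of g h] by (simp add: monic_F2_def d)
  moreover have "poly.coeff h 0 = 1"
    using assms by (simp add: monic_F2_def coeff_mult_0)
  ultimately show "h \<in> monic_F2 (d - m)" by (simp add: monic_F2_def d)
qed

section \<open>Frobenius orbits and powers of minimal polynomials\<close>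

text \<open>A power of the minimal polynomial of \<open>\<alpha>\<close> over the prime field, if \<open>\<alpha> \<in> F2pow n\<close>.\<close>

definition conj_poly :: "nat \<Rightarrow> ambient \<Rightarrow> ambient poly" where
  "conj_poly n \<alpha> = (\<Prod>i<n. [:- (\<alpha> ^ (2 ^ i)), 1:])"

text \<open>Frobenius permutes the factors cyclically because
  \<open>\<alpha> ^ (2 ^ n) = \<alpha>\<close>. The constant term is a product of nonzero
  conjugates, and among the bits 0 and 1 this leaves 1.\<close>

lemma conj_poly_monic_F2:
  assumes "\<alpha> \<in> F2pow n - {0}"
  shows "conj_poly n \<alpha> \<in> monic_F2 n"
proof -
  have deg: "Polynomial.degree (conj_poly n \<alpha>) = n"
    by (simp add: conj_poly_def degree_prod_eq_sum_degree)
  have lc: "poly.coeff (conj_poly n \<alpha>) n = 1"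
  proof -
    have "Polynomial.lead_coeff (conj_poly n \<alpha>) = 1"
      unfolding conj_poly_def lead_coeff_prod by simp
    thus ?thesis by (simp only: deg)
  qed
  have "frob_poly (conj_poly n \<alpha>) = (\<Prod>i<n. [:- (\<alpha> ^ (2 ^ Suc i)), 1:])"
    unfolding conj_poly_def frob_poly_prod
    by (intro prod.cong refl) (simp add: frob_poly_pCons mult.commute flip: power_mult)
  also have "\<dots> = conj_poly n \<alpha>"
  proof (cases n)
    case (Suc m)
    have "\<alpha> ^ (2 ^ Suc m) = \<alpha>" using assms Suc by (simp add: F2pow_def)
    thus ?thesis unfolding conj_poly_def Suc
      by (subst prod.lessThan_Suc, subst prod.lessThan_Suc_shift)
         (simp add: mult.commute del: power_Suc)
  qed (simp add: conj_poly_def)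
  finally have fixed: "frob_poly (conj_poly n \<alpha>) = conj_poly n \<alpha>" .
  have "poly.coeff (conj_poly n \<alpha>) 0 = (\<Prod>i<n. \<alpha> ^ (2 ^ i))"
    by (simp add: conj_poly_def poly_prod flip: poly_0_coeff_0)
  hence "poly.coeff (conj_poly n \<alpha>) 0 \<noteq> 0" using assms by simp
  hence "poly.coeff (conj_poly n \<alpha>) 0 = 1" using fixed by (auto simp: frob_poly_fixed_iff)
  thus ?thesis using deg lc fixed by (simp add: monic_F2_def)
qed

lemma proots_conj_poly: "proots (conj_poly n \<alpha>) = (\<Sum>i<n. {#\<alpha> ^ (2 ^ i)#})"
  unfolding conj_poly_def by (subst proots_prod) auto

lemma monic_dvd_iff_proots_subset:
  fixes g h :: "'a :: alg_closed_field poly"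
  assumes "h \<noteq> 0" "g \<noteq> 0"
  shows "g dvd h \<longleftrightarrow> proots g \<subseteq># proots h"
proof
  assume "g dvd h"
  then obtain k where "h = g * k" ..
  with assms show "proots g \<subseteq># proots h" by (auto simp: proots_mult)
next
  assume "proots g \<subseteq># proots h"
  hence "(\<Prod>x\<in>#proots g. [:- x, 1:]) dvd (\<Prod>x\<in>#proots h. [:- x, 1:])"
    by (metis dvd_triv_left image_mset_union prod_mset.union subset_mset.le_iff_add)
  moreover have "Polynomial.smult c p dvd Polynomial.smult d q \<longleftrightarrow> p dvd q"
    if "c \<noteq> 0" "d \<noteq> 0" for c d :: 'a and p q
    using that by (simp add: smult_dvd_iff dvd_smult_iff)
  ultimately show "g dvd h"
    using alg_closed_factorization(1)[OF assms(1)] alg_closed_factorization(1)[OF assms(2)] assms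
    by (metis leading_coeff_0_iff)
qed

lemma proots_frob_poly: "proots (frob_poly h) = image_mset (\<lambda>x. x ^ 2) (proots h)"
proof (cases "h = 0")
  case False
  have sm: "frob_poly (Polynomial.smult c g) = Polynomial.smult (c ^ 2) (frob_poly g)" for c g
    by (rule poly_eqI) (simp add: coeff_frob_poly power_mult_distrib)
  have pr: "frob_poly (\<Prod>x\<in>#A. [:- x, 1:]) = (\<Prod>x\<in>#image_mset (\<lambda>x. x ^ 2) A. [:- x, 1:])" for A
    by (induction A) (simp_all add: frob_poly_mult frob_poly_pCons del: mult_pCons_left)
  have "proots (frob_poly h) = proots (frob_poly (Polynomial.smult (Polynomial.lead_coeff h)
          (\<Prod>x\<in>#proots h. [:- x, 1:])))"
    by (simp only: alg_closed_factorization(1)[OF False])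
  also have "\<dots> = proots (\<Prod>x\<in>#image_mset (\<lambda>x. x ^ 2) (proots h). [:- x, 1:])"
    unfolding sm pr by (rule proots_smult) (use False in simp)
  also have "\<dots> = image_mset (\<lambda>x. x ^ 2) (proots h)"
    by (rule proots_prod_linear)
  finally show ?thesis .
qed simp

lemma inj_frobenius: "inj (\<lambda>x :: ambient. x ^ (2 ^ n))"
  by (rule injI) (simp add: frobenius_eq_iff)

lemma count_image_mset_inj': "inj f \<Longrightarrow> count (image_mset f M) (f x) = count M x"
  by (induction M) (auto simp: inj_eq)

lemma count_proots_frobenius:
  assumes "frob_poly h = h"
  shows "count (proots h) (x ^ (2 ^ i)) = count (proots h) x"
proof (induction i)
  case (Suc i)
  have inj: "inj (\<lambda>x :: ambient. x ^ 2)" using inj_frobenius[of 1] by simp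
  have "x ^ (2 ^ Suc i) = (x ^ (2 ^ i)) ^ 2"
    by (metis power_Suc2 power_mult)
  hence "count (proots h) (x ^ (2 ^ Suc i)) =
           count (image_mset (\<lambda>x. x ^ 2) (proots h)) ((x ^ (2 ^ i)) ^ 2)"
    using proots_frob_poly[of h] assms by simp
  also have "\<dots> = count (proots h) (x ^ (2 ^ i))"
    by (rule count_image_mset_inj'[OF inj])
  finally show ?case using Suc by simp
qed simp

lemma sum_lessThan_add:
  "(\<Sum>i<m + n. f i :: 'a :: comm_monoid_add) = (\<Sum>i<m. f i) + (\<Sum>i<n. f (m + i))" for m n :: nat
  by (induction n) (simp_all add: add_ac)

text \<open>Let \<open>m\<close> be the degree of \<alpha> over \<open>F\<^sub>2\<close>. The
  \<open>n\<close> with \<open>\<alpha> \<in> F2pow n\<close> are the multiples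
  \<open>j * m\<close>, and \<open>conj_poly (j * m) \<alpha>\<close> is the \<open>j\<close>-th
  power of the minimal polynomial of \<alpha>, which divides \<open>h\<close> exactly as long as
  \<open>j\<close> is at most the multiplicity of the root.\<close>

lemma conj_poly_dvd_count:
  assumes h: "h \<in> monic_F2 d" and root: "poly h \<alpha> = 0"
  shows "card {n \<in> {1..d}. \<alpha> \<in> F2pow n \<and> conj_poly n \<alpha> dvd h} = count (proots h) \<alpha>"
proof -
  have h0: "h \<noteq> 0" and fr: "frob_poly h = h" using h by (auto simp: monic_F2_def)
  define \<phi> where "\<phi> = (\<lambda>i::nat. \<alpha> ^ (2 ^ i))"
  have \<phi>_add: "\<phi> (i + j) = \<phi> i ^ (2 ^ j)" for i j
    by (simp add: \<phi>_def power_add flip: power_mult)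
  have \<phi>0: "\<phi> 0 = \<alpha>" by (simp add: \<phi>_def)
  \<comment> \<open>The Frobenius orbit of \<alpha> stays in the finite root set of
    \<open>h\<close>, so two iterates agree; injectivity of Frobenius strips off the first
    \<open>i\<close> steps.\<close>
  have "\<exists>m>0. \<phi> m = \<alpha>"
  proof -
    have "range \<phi> \<subseteq> {x. poly h x = 0}"
      using root_frobenius_orbit[OF fr root] by (auto simp: \<phi>_def)
    hence "finite (range \<phi>)" using poly_roots_finite[OF h0] by (rule finite_subset)
    hence "\<not> inj \<phi>" using finite_imageD by blast
    then obtain i j where ij: "i < j" "\<phi> i = \<phi> j"
      by (metis injI linorder_neqE_nat)
    have "\<phi> (j - i) ^ (2 ^ i) = \<phi> j" using \<phi>_add[of "j - i" i] ij by simp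
    also have "\<dots> = \<alpha> ^ (2 ^ i)" using ij by (simp add: \<phi>_def)
    finally have "\<phi> (j - i) = \<alpha>" by (simp add: frobenius_eq_iff)
    thus ?thesis using ij by (intro exI[of _ "j - i"]) auto
  qed
  then obtain m0 where m0: "m0 > 0 \<and> \<phi> m0 = \<alpha>" by blast
  define m where "m = (LEAST m. m > 0 \<and> \<phi> m = \<alpha>)"
  have "m > 0 \<and> \<phi> m = \<alpha>" unfolding m_def using m0 by (rule LeastI)
  hence m: "m > 0" "\<phi> m = \<alpha>" by auto
  have m_min: "i = 0" if "i < m" "\<phi> i = \<alpha>" for i
    using not_less_Least[OF that(1)[unfolded m_def]] that(2) by simp
  have per: "\<phi> (m + i) = \<phi> i" for i
    using \<phi>_add[of m i] m by (simp add: \<phi>_def)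
  have per': "\<phi> (j * m + i) = \<phi> i" for i j
    by (induction j) (use per in \<open>auto simp: add.assoc\<close>)
  have dvd: "\<alpha> \<in> F2pow n \<longleftrightarrow> m dvd n" for n
  proof -
    have "\<phi> n = \<phi> (n mod m)" using per'[of "n div m" "n mod m"] by simp
    moreover have "\<phi> (n mod m) = \<alpha> \<longleftrightarrow> n mod m = 0"
      using m_min[of "n mod m"] \<phi>0 \<open>m > 0\<close> by auto
    ultimately show ?thesis
      by (simp add: dvd_eq_mod_eq_0 F2pow_def \<phi>_def)
  qed
  have inj: "inj_on \<phi> {..<m}"
  proof (rule linorder_inj_onI')
    fix i j assume ij: "i \<in> {..<m}" "j \<in> {..<m}" "i < j"
    have "j - i < m" "j - i \<noteq> 0" using ij by auto
    hence "\<phi> (j - i) \<noteq> \<alpha>" using m_min[of "j - i"] by metis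
    hence "\<phi> (j - i) ^ (2 ^ i) \<noteq> \<alpha> ^ (2 ^ i)" by (simp add: frobenius_eq_iff)
    moreover have "\<phi> (j - i) ^ (2 ^ i) = \<phi> j" using \<phi>_add[of "j - i" i] ij by simp
    ultimately show "\<phi> i \<noteq> \<phi> j" by (metis \<phi>_def)
  qed
  \<comment> \<open>The root multiset of the minimal polynomial of \<alpha>: one full Frobenius
    orbit, without repetitions.\<close>
  define M where "M = (\<Sum>i<m. {#\<phi> i#})"
  have M_count: "count M \<beta> = (if \<beta> \<in> \<phi> ` {..<m} then 1 else 0)" for \<beta>
  proof -
    have "count M \<beta> = (\<Sum>i<m. if \<phi> i = \<beta> then 1 else 0)"
      unfolding M_def count_sum by (intro sum.cong refl) auto
    also have "\<dots> = (\<Sum>\<gamma>\<in>\<phi> ` {..<m}. if \<gamma> = \<beta> then 1 else 0)"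
      by (simp add: sum.reindex[OF inj])
    finally show ?thesis by simp
  qed
  have proots: "proots (conj_poly (j * m) \<alpha>) = repeat_mset j M" for j
  proof (induction j)
    case (Suc j)
    have "proots (conj_poly (Suc j * m) \<alpha>) = (\<Sum>i<j * m + m. {#\<phi> i#})"
      by (simp add: proots_conj_poly \<phi>_def add.commute)
    also have "\<dots> = (\<Sum>i<j * m. {#\<phi> i#}) + (\<Sum>i<m. {#\<phi> (j * m + i)#})"
      by (rule sum_lessThan_add)
    also have "(\<Sum>i<m. {#\<phi> (j * m + i)#}) = M" by (simp add: per' M_def)
    also have "(\<Sum>i<j * m. {#\<phi> i#}) = repeat_mset j M"
      using Suc by (simp add: proots_conj_poly \<phi>_def)
    finally show ?case by simp
  qed (simp add: proots_conj_poly)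
  have nz: "conj_poly n \<alpha> \<noteq> 0" for n by (simp add: conj_poly_def)
  have main: "conj_poly (j * m) \<alpha> dvd h \<longleftrightarrow> j \<le> count (proots h) \<alpha>" for j
  proof -
    have "conj_poly (j * m) \<alpha> dvd h \<longleftrightarrow> (\<forall>\<beta>. j * count M \<beta> \<le> count (proots h) \<beta>)"
      using monic_dvd_iff_proots_subset[OF h0 nz] by (simp add: proots subseteq_mset_def)
    also have "\<dots> \<longleftrightarrow> (\<forall>\<beta>\<in>\<phi> ` {..<m}. j \<le> count (proots h) \<beta>)"
      by (auto simp: M_count)
    \<comment> \<open>Conjugate roots have the same multiplicity in \<open>h\<close>.\<close>
    also have "\<dots> \<longleftrightarrow> j \<le> count (proots h) \<alpha>"
      using m count_proots_frobenius[OF fr, of \<alpha>] by (auto simp: \<phi>_def)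
    finally show ?thesis .
  qed
  have deg: "Polynomial.degree (conj_poly n \<alpha>) = n" for n
    by (simp add: conj_poly_def degree_prod_eq_sum_degree)
  have "{n \<in> {1..d}. \<alpha> \<in> F2pow n \<and> conj_poly n \<alpha> dvd h} = (\<lambda>j. j * m) ` {1..count (proots h) \<alpha>}"
  proof (intro equalityI subsetI)
    fix n assume n: "n \<in> {n \<in> {1..d}. \<alpha> \<in> F2pow n \<and> conj_poly n \<alpha> dvd h}"
    then obtain j where "n = j * m" using dvd by (auto elim: dvdE simp: mult.commute)
    moreover from this have "j \<ge> 1" using n by (cases j) auto
    moreover have "j \<le> count (proots h) \<alpha>" using n main \<open>n = j * m\<close> by simp
    ultimately show "n \<in> (\<lambda>j. j * m) ` {1..count (proots h) \<alpha>}" by auto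
  next
    fix n assume "n \<in> (\<lambda>j. j * m) ` {1..count (proots h) \<alpha>}"
    then obtain j where j': "n = j * m" "j \<in> {1..count (proots h) \<alpha>}" by blast
    hence j: "n = j * m" "1 \<le> j" "j \<le> count (proots h) \<alpha>" by auto
    hence "conj_poly n \<alpha> dvd h" using main by simp
    moreover from this have "n \<le> d"
      using dvd_imp_degree_le[OF _ h0] deg h by (metis (lifting) mem_Collect_eq monic_F2_def)
    ultimately show "n \<in> {n \<in> {1..d}. \<alpha> \<in> F2pow n \<and> conj_poly n \<alpha> dvd h}"
      using j m dvd by auto
  qed
  moreover have "inj_on (\<lambda>j. j * m) A" for A using m by (auto intro: inj_onI)
  ultimately show ?thesis by (simp add: card_image)
qed

text \<open>For each root the admissible \<open>n\<close> count its multiplicity, and the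
  multiplicities add up to the degree. In terms of irreducible polynomials \<open>P\<close>: the sum
  of \<open>deg P\<close> over all powers \<open>P^j\<close>, \<open>j \<ge> 1\<close>, that divide
  \<open>h\<close> is \<open>deg h\<close>.\<close>

lemma card_conj_poly_divisors:
  assumes h: "h \<in> monic_F2 d"
  shows "card {(n, \<alpha>). n \<in> {1..d} \<and> \<alpha> \<in> F2pow n - {0} \<and> conj_poly n \<alpha> dvd h} = d"
proof -
  define N where "N = (\<lambda>\<alpha>. {n \<in> {1..d}. \<alpha> \<in> F2pow n \<and> conj_poly n \<alpha> dvd h})"
  define Z where "Z = {\<alpha>. poly h \<alpha> = 0}"
  have h0: "h \<noteq> 0" using h by (rule monic_F2_nonzero)
  have finZ: "finite Z" unfolding Z_def by (rule poly_roots_finite[OF h0])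
  have nonzero: "0 \<notin> Z" using h by (simp add: Z_def monic_F2_def poly_0_coeff_0)
  have root: "\<alpha> \<in> Z" if n: "n \<ge> 1" and d: "conj_poly n \<alpha> dvd h" for n \<alpha>
  proof -
    have "poly (conj_poly n \<alpha>) \<alpha> = 0"
      using n by (auto simp: conj_poly_def poly_prod intro!: bexI[of _ 0])
    thus ?thesis using d by (auto simp: Z_def)
  qed
  have "{(n, \<alpha>). n \<in> {1..d} \<and> \<alpha> \<in> F2pow n - {0} \<and> conj_poly n \<alpha> dvd h} =
          (\<lambda>(\<alpha>, n). (n, \<alpha>)) ` (SIGMA \<alpha>:Z. N \<alpha>)"
    using root nonzero by (fastforce simp: N_def image_iff)
  hence "card {(n, \<alpha>). n \<in> {1..d} \<and> \<alpha> \<in> F2pow n - {0} \<and> conj_poly n \<alpha> dvd h} =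
          card (SIGMA \<alpha>:Z. N \<alpha>)"
    by (simp add: card_image inj_on_def split: prod.splits)
  also have "\<dots> = (\<Sum>\<alpha>\<in>Z. card (N \<alpha>))"
    by (rule card_SigmaI[OF finZ]) (simp add: N_def)
  also have "\<dots> = (\<Sum>\<alpha>\<in>Z. count (proots h) \<alpha>)"
    using conj_poly_dvd_count[OF h] by (intro sum.cong refl) (simp add: Z_def N_def)
  also have "\<dots> = size (proots h)"
    by (simp add: size_multiset_overloaded_eq Z_def set_count_proots[OF h0])
  also have "\<dots> = d" using alg_closed_factorization(2)[OF h0] h by (simp add: monic_F2_def)
  finally show ?thesis .
qed

section \<open>The character of a polynomial\<close>

text \<open>For the reversed polynomial of a monic \<open>h\<close>, the product of the
  \<open>1 - z X\<close> over the roots \<open>z\<close> of \<open>h\<close>, the coefficient of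
  \<open>X^n\<close> is the \<open>n\<close>-th power sum of the roots, up to a sign that is
  invisible in characteristic two. The factor \<open>X\<close> aligns the index.\<close>

definition log_deriv :: "ambient fps \<Rightarrow> ambient fps" where
  "log_deriv R = fps_X * fps_deriv R * inverse R"

lemma log_deriv_mult:
  assumes "fps_nth R 0 \<noteq> 0" "fps_nth S 0 \<noteq> 0"
  shows "log_deriv (R * S) = log_deriv R + log_deriv S"
proof -
  have R: "R * inverse R = 1" and S: "S * inverse S = 1"
    using assms by (auto simp: inverse_mult_eq_1')
  have "log_deriv (R * S) =
          fps_X * fps_deriv R * inverse R * (S * inverse S) + fps_X * fps_deriv S * inverse S * (R * inverse R)"
    unfolding log_deriv_def fps_inverse_mult fps_deriv_mult by (simp only: distrib_left distrib_right mult_ac add_ac)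
  thus ?thesis by (simp add: R S log_deriv_def)
qed

text \<open>If \<open>h\<close> has the roots \<open>\<alpha>\<^sub>i\<close>, this is the sum of all \<open>\<alpha>\<^sub>i ^ (2 ^ k + 1) + 1 / \<alpha>\<^sub>i\<close>.\<close>

definition char_exp :: "nat \<Rightarrow> ambient poly \<Rightarrow> ambient" where
  "char_exp k h = fps_nth (log_deriv (fps_of_poly (reflect_poly h))) (2 ^ k + 1) +
     poly.coeff h 1 / poly.coeff h 0"

text \<open>Both summands are logarithmic derivatives: the first that of the reversed polynomial,
  the second, \<open>h'(0) / h(0)\<close>, that of \<open>h\<close> at 0. Hence products turn into
  sums.\<close>

lemma char_exp_mult:
  assumes "poly.coeff g 0 \<noteq> 0" "poly.coeff h 0 \<noteq> 0"
  shows "char_exp k (g * h) = char_exp k g + char_exp k h"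
proof -
  have "g \<noteq> 0" "h \<noteq> 0" using assms by auto
  hence "log_deriv (fps_of_poly (reflect_poly (g * h))) =
           log_deriv (fps_of_poly (reflect_poly g)) + log_deriv (fps_of_poly (reflect_poly h))"
    by (simp add: reflect_poly_mult fps_of_poly_mult log_deriv_mult)
  moreover have "poly.coeff (g * h) 1 / poly.coeff (g * h) 0 =
      poly.coeff g 1 / poly.coeff g 0 + poly.coeff h 1 / poly.coeff h 0"
  proof -
    have "poly.coeff (g * h) 1 = poly.coeff g 0 * poly.coeff h 1 + poly.coeff g 1 * poly.coeff h 0"
      by (simp add: coeff_mult)
    thus ?thesis using assms by (simp add: coeff_mult_0 add_divide_distrib)
  qed
  ultimately show ?thesis by (simp only: char_exp_def fps_add_nth) (simp only: add_ac)
qed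

lemma char_exp_1: "char_exp k 1 = 0"
  by (simp add: char_exp_def log_deriv_def)

lemma char_exp_prod:
  assumes "\<And>i. i \<in> I \<Longrightarrow> poly.coeff (f i) 0 \<noteq> 0"
  shows "char_exp k (\<Prod>i\<in>I. f i) = (\<Sum>i\<in>I. char_exp k (f i))"
proof -
  have "poly.coeff (\<Prod>i\<in>J. f i) 0 \<noteq> 0 \<and> char_exp k (\<Prod>i\<in>J. f i) = (\<Sum>i\<in>J. char_exp k (f i))"
    if "J \<subseteq> I" for J
    using that
    by (induction J rule: infinite_finite_induct)
       (use assms in \<open>auto simp: char_exp_1 char_exp_mult coeff_mult_0\<close>)
  thus ?thesis by blast
qed

text \<open>In characteristic two \<open>[:a, 1:]\<close> has the root \<open>a\<close>; the inverse
  of its reversed polynomial \<open>1 + a X\<close> is the geometric series.\<close>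

lemma char_exp_linear:
  assumes "a \<noteq> 0"
  shows "char_exp k [:a, 1:] = a ^ (2 ^ k + 1) + inverse a"
proof -
  define P where "P = Abs_fps (\<lambda>n. a ^ n)"
  define R where "R = fps_of_poly (reflect_poly [:a, 1:])"
  have "reflect_poly [:a, 1:] = [:1, a:]"
    using assms by (simp add: reflect_poly_def)
  hence R: "R = 1 + fps_const a * fps_X"
    by (simp add: R_def fps_of_poly_pCons mult.commute)
  have "R * P = 1"
  proof (rule fps_ext)
    fix n show "fps_nth (R * P) n = fps_nth 1 n"
      by (cases n) (simp_all add: R P_def distrib_right mult.assoc)
  qed
  hence "inverse R = P" by (rule fps_inverse_unique)
  hence "log_deriv R = fps_X * (fps_const a * P)"
    by (simp add: log_deriv_def R mult.assoc)
  hence "fps_nth (log_deriv R) (2 ^ k + 1) = a ^ (2 ^ k + 1)"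
    by (simp add: P_def)
  thus ?thesis by (simp add: char_exp_def R_def inverse_eq_divide)
qed

text \<open>The map that sends \<open>x\<close> to \<open>x^(2^k+1) + 1/x\<close> commutes with
  Frobenius, so its sum over the conjugates is a trace. This links the signs in \<open>G\<close> to
  characters of polynomials.\<close>

lemma char_exp_conj_poly:
  assumes "\<alpha> \<noteq> 0"
  shows "char_exp k (conj_poly n \<alpha>) = trace2 n (\<alpha> ^ (2 ^ k + 1) + inverse \<alpha>)"
proof -
  have "char_exp k (conj_poly n \<alpha>) = (\<Sum>i<n. char_exp k [:\<alpha> ^ (2 ^ i), 1:])"
    unfolding conj_poly_def using assms by (subst char_exp_prod) auto
  also have "\<dots> = (\<Sum>i<n. (\<alpha> ^ (2 ^ k + 1) + inverse \<alpha>) ^ (2 ^ i))"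
  proof (intro sum.cong refl)
    fix i
    have "(\<alpha> ^ (2 ^ i)) ^ (2 ^ k + 1) = (\<alpha> ^ (2 ^ k + 1)) ^ (2 ^ i)"
      by (simp only: mult.commute flip: power_mult)
    thus "char_exp k [:\<alpha> ^ (2 ^ i), 1:] = (\<alpha> ^ (2 ^ k + 1) + inverse \<alpha>) ^ (2 ^ i)"
      using assms by (simp only: char_exp_linear frobenius_add power_inverse power_not_zero not_False_eq_True)
  qed
  finally show ?thesis by (simp only: trace2_def)
qed

lemma F2pow_fps_mult:
  assumes "\<And>i. fps_nth A i \<in> F2pow n" "\<And>i. fps_nth B i \<in> F2pow n"
  shows "fps_nth (A * B) i \<in> F2pow n"
  unfolding fps_mult_nth by (intro F2pow_sum F2pow_mult assms)

lemma F2pow_fps_inverse: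
  assumes "fps_nth A 0 = 1" "\<And>i. fps_nth A i \<in> F2pow n"
  shows "fps_nth (inverse A) i \<in> F2pow n"
proof (induction i rule: less_induct)
  case (less i)
  show ?case
  proof (cases i)
    case 0
    thus ?thesis using assms by simp
  next
    case (Suc j)
    have "A * inverse A = 1" using assms by (simp add: inverse_mult_eq_1')
    hence "fps_nth (A * inverse A) i = 0" using Suc by (simp only: fps_one_nth) simp
    hence "(\<Sum>l=0..i. fps_nth A l * fps_nth (inverse A) (i - l)) = 0"
      by (simp only: fps_mult_nth)
    hence "fps_nth (inverse A) i + (\<Sum>l=1..i. fps_nth A l * fps_nth (inverse A) (i - l)) = 0"
      by (subst (asm) sum.atLeast_Suc_atMost) (simp_all add: assms(1))
    hence "fps_nth (inverse A) i = (\<Sum>l=1..i. fps_nth A l * fps_nth (inverse A) (i - l))"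
      by (simp only: ambient_add_eq_0_iff)
    also have "\<dots> \<in> F2pow n"
      by (intro F2pow_sum F2pow_mult assms less) (use Suc in auto)
    finally show ?thesis .
  qed
qed

text \<open>Everything is computed from the coefficients by field operations, so the value stays in
  the prime field. Only then does the zero test in \<open>chi\<close> give a multiplicative sign:
  \<open>1 + 1 = 0\<close> matches \<open>(-1) * (-1) = 1\<close>.\<close>

lemma char_exp_bit:
  assumes "h \<in> monic_F2 d"
  shows "char_exp k h \<in> {0, 1}"
proof -
  define R where "R = fps_of_poly (reflect_poly h)"
  have coeff: "poly.coeff h i \<in> F2pow 1" for i
    using assms by (auto simp: monic_F2_def frob_poly_fixed_iff F2pow_Suc_0)
  hence R: "fps_nth R i \<in> F2pow 1" for i
    by (auto simp: R_def coeff_reflect_poly)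
  have R0: "fps_nth R 0 = 1" using assms by (simp add: R_def monic_F2_def)
  have of_nat: "of_nat i \<in> F2pow 1" for i
    by (induction i) (auto intro: F2pow_add)
  have dR: "fps_nth (fps_deriv R) i \<in> F2pow 1" for i
    using F2pow_mult[OF of_nat[of "Suc i"] R[of "Suc i"]] by (simp add: fps_deriv_nth)
  have X: "fps_nth fps_X i \<in> F2pow 1" for i
    by (simp add: fps_X_def)
  have "fps_nth (log_deriv R) i \<in> F2pow 1" for i
    unfolding log_deriv_def by (intro F2pow_fps_mult F2pow_fps_inverse X dR R R0)
  hence "char_exp k h \<in> F2pow 1"
    unfolding char_exp_def divide_inverse R_def[symmetric]
    by (intro F2pow_add F2pow_mult F2pow_inverse coeff)
  thus ?thesis by (simp add: F2pow_Suc_0)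
qed

section \<open>Character sums over monic polynomials\<close>

definition chi :: "nat \<Rightarrow> ambient poly \<Rightarrow> int" where
  "chi k h = (if char_exp k h = 0 then 1 else -1)"

definition chi_sum :: "nat \<Rightarrow> nat \<Rightarrow> int" where
  "chi_sum k d = (\<Sum>h\<in>monic_F2 d. chi k h)"

lemma chi_mult:
  assumes "g \<in> monic_F2 m" "h \<in> monic_F2 n"
  shows "chi k (g * h) = chi k g * chi k h"
proof -
  have "char_exp k (g * h) = char_exp k g + char_exp k h"
    by (rule char_exp_mult) (use assms in \<open>auto simp: monic_F2_def\<close>)
  thus ?thesis using char_exp_bit[OF assms(1), of k] char_exp_bit[OF assms(2), of k]
    by (auto simp: chi_def)
qed

lemma G_eq_chi_sum: "G k n = (\<Sum>\<alpha>\<in>F2pow n - {0}. chi k (conj_poly n \<alpha>))"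
  unfolding G_def chi_def
  by (intro sum.cong refl) (simp only: char_exp_conj_poly Diff_iff singleton_iff not_False_eq_True)

lemma chi_sum_multiples:
  assumes "\<alpha> \<in> F2pow n - {0}" "n \<le> d"
  shows "(\<Sum>h | h \<in> monic_F2 d \<and> conj_poly n \<alpha> dvd h. chi k h) =
           chi k (conj_poly n \<alpha>) * chi_sum k (d - n)"
proof -
  let ?P = "conj_poly n \<alpha>"
  have P: "?P \<in> monic_F2 n" by (rule conj_poly_monic_F2[OF assms(1)])
  have "{h. h \<in> monic_F2 d \<and> ?P dvd h} = (\<lambda>g. ?P * g) ` monic_F2 (d - n)"
  proof (intro equalityI subsetI)
    fix h assume "h \<in> {h. h \<in> monic_F2 d \<and> ?P dvd h}"
    then obtain g where "h = ?P * g" "h \<in> monic_F2 d" by (auto elim: dvdE)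
    thus "h \<in> (\<lambda>g. ?P * g) ` monic_F2 (d - n)" using monic_F2_divide(2) P by blast
  next
    fix h assume "h \<in> (\<lambda>g. ?P * g) ` monic_F2 (d - n)"
    thus "h \<in> {h. h \<in> monic_F2 d \<and> ?P dvd h}"
      using monic_F2_mult[OF P, of _ "d - n"] assms(2) by auto
  qed
  moreover have "inj_on (\<lambda>g. ?P * g) A" for A
    using monic_F2_nonzero[OF P] by (auto intro: inj_onI)
  ultimately have "(\<Sum>h | h \<in> monic_F2 d \<and> ?P dvd h. chi k h) = (\<Sum>g\<in>monic_F2 (d - n). chi k (?P * g))"
    by (simp add: sum.reindex)
  also have "\<dots> = (\<Sum>g\<in>monic_F2 (d - n). chi k ?P * chi k g)"
    using chi_mult[OF P] by (intro sum.cong refl) blast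
  finally show ?thesis by (simp add: chi_sum_def sum_distrib_left)
qed

text \<open>The logarithmic derivative of the Euler product of the L-function: count the pairs of a
  polynomial \<open>h\<close> of degree \<open>d\<close> and a divisor \<open>conj_poly n \<alpha>\<close> of \<open>h\<close> in two ways.\<close>

lemma chi_sum_recurrence: "int d * chi_sum k d = (\<Sum>n=1..d. G k n * chi_sum k (d - n))"
proof -
  define S where "S = (SIGMA n:{1..d}. F2pow n - {0})"
  have finS: "finite S" unfolding S_def using finite_F2pow by (intro finite_SigmaI) auto
  let ?D = "\<lambda>p h. conj_poly (fst p) (snd p) dvd h"
  have "int d * chi_sum k d = (\<Sum>h\<in>monic_F2 d. int (card {p \<in> S. ?D p h}) * chi k h)"
  proof -
    have "card {p \<in> S. ?D p h} = d" if "h \<in> monic_F2 d" for h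
    proof -
      have "{p \<in> S. ?D p h} = {(n, \<alpha>). n \<in> {1..d} \<and> \<alpha> \<in> F2pow n - {0} \<and> conj_poly n \<alpha> dvd h}"
        by (auto simp: S_def)
      thus ?thesis using card_conj_poly_divisors[OF that] by simp
    qed
    thus ?thesis by (simp add: chi_sum_def sum_distrib_left)
  qed
  also have "\<dots> = (\<Sum>h\<in>monic_F2 d. \<Sum>p\<in>S. if ?D p h then chi k h else 0)"
    using finS by (intro sum.cong refl) (simp add: sum.If_cases Int_def)
  also have "\<dots> = (\<Sum>p\<in>S. \<Sum>h\<in>monic_F2 d. if ?D p h then chi k h else 0)"
    by (rule sum.swap)
  also have "\<dots> = (\<Sum>p\<in>S. chi k (conj_poly (fst p) (snd p)) * chi_sum k (d - fst p))"
  proof (intro sum.cong refl)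
    fix p assume p: "p \<in> S"
    have "(\<Sum>h\<in>monic_F2 d. if ?D p h then chi k h else 0) = (\<Sum>h | h \<in> monic_F2 d \<and> ?D p h. chi k h)"
      using finite_monic_F2 by (simp add: sum.If_cases Int_def)
    also have "\<dots> = chi k (conj_poly (fst p) (snd p)) * chi_sum k (d - fst p)"
      by (rule chi_sum_multiples) (use p in \<open>auto simp: S_def\<close>)
    finally show "(\<Sum>h\<in>monic_F2 d. if ?D p h then chi k h else 0) =
                    chi k (conj_poly (fst p) (snd p)) * chi_sum k (d - fst p)" .
  qed
  also have "\<dots> = (\<Sum>n=1..d. \<Sum>\<alpha>\<in>F2pow n - {0}. chi k (conj_poly n \<alpha>) * chi_sum k (d - n))"
    unfolding S_def by (subst sum.Sigma) (use finite_F2pow in \<open>auto simp: case_prod_unfold\<close>)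
  also have "\<dots> = (\<Sum>n=1..d. G k n * chi_sum k (d - n))"
    by (simp add: G_eq_chi_sum sum_distrib_right)
  finally show ?thesis .
qed

lemma chi_sum_0: "chi_sum k 0 = 1"
proof -
  have "monic_F2 0 = {1}"
  proof (intro equalityI subsetI)
    fix h assume h: "h \<in> monic_F2 0"
    then obtain c where "h = [:c:]" by (auto simp: monic_F2_def elim: degree_eq_zeroE)
    thus "h \<in> {1}" using h by (auto simp: monic_F2_def one_pCons)
  qed (auto simp: monic_F2_def)
  thus ?thesis by (simp add: chi_sum_def chi_def char_exp_1)
qed

text \<open>The difference of the two sides is \<open>X (S' R - R' S) / (R S)\<close>.
  Differentiating \<open>X^e\<close> loses one exponent, which the factor \<open>X\<close> in
  \<open>log_deriv\<close> restores, so the numerator is divisible by \<open>X^e\<close>.\<close>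

lemma log_deriv_cong:
  assumes "fps_nth R 0 = 1" "fps_nth S 0 = 1" "S = R + fps_X ^ e" "i < e"
  shows "fps_nth (log_deriv S) i = fps_nth (log_deriv R) i"
proof -
  have R: "R * inverse R = 1" and S: "S * inverse S = 1"
    using assms by (auto simp: inverse_mult_eq_1')
  obtain e' where e: "e = Suc e'" using assms(4) by (cases e) auto
  define T where "T = (of_nat e * R - fps_X * fps_deriv R) * inverse R * inverse S"
  have "log_deriv S - log_deriv R =
          fps_X * (fps_deriv S * R - fps_deriv R * S) * inverse R * inverse S"
  proof -
    have "log_deriv S = fps_X * fps_deriv S * inverse S * (R * inverse R)"
      and "log_deriv R = fps_X * fps_deriv R * inverse R * (S * inverse S)"
      by (simp_all only: R S log_deriv_def mult_1_right)
    thus ?thesis by (simp only: left_diff_distrib right_diff_distrib mult_ac)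
  qed
  also have "fps_X * (fps_deriv S * R - fps_deriv R * S) =
               fps_X ^ e * (of_nat e * R - fps_X * fps_deriv R)"
  proof -
    have "fps_deriv S = fps_deriv R + of_nat e * fps_X ^ e'"
      by (simp add: assms(3) e fps_deriv_power' del: power_Suc)
    moreover have "x * ((d + n * y) * r - d * (r + x * y)) = x * y * (n * r - x * d)"
      for x d n y r :: "ambient fps" by (simp add: algebra_simps)
    ultimately show ?thesis unfolding assms(3) e power_Suc by (simp only:)
  qed
  finally have "log_deriv S - log_deriv R = fps_X ^ e * T"
    by (simp only: T_def mult.assoc)
  hence "fps_nth (log_deriv S - log_deriv R) i = 0"
    using assms(4) by (simp add: fps_X_power_mult_nth)
  thus ?thesis by (simp only: fps_sub_nth ambient_diff ambient_add_eq_0_iff)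
qed

text \<open>Adding \<open>X\<close> changes the sum of the inverses of the roots, but no power sum of low order.\<close>

lemma chi_sum_vanish:
  assumes d: "d \<ge> 2 ^ k + 3"
  shows "chi_sum k d = 0"
proof -
  define U :: "ambient poly" where "U = Polynomial.monom 1 1"
  have coeffU: "poly.coeff U i = (if i = 1 then 1 else 0)" for i by (simp add: U_def)
  have UU: "U + U = 0" by (rule poly_eqI) (simp only: coeff_add ambient_add_self coeff_0)
  have mem: "h + U \<in> monic_F2 d" if "h \<in> monic_F2 d" for h
  proof -
    have "Polynomial.degree U < Polynomial.degree h"
      using that d by (simp add: U_def degree_monom_eq monic_F2_def)
    hence "Polynomial.degree (h + U) = Polynomial.degree h" by (rule degree_add_eq_left)
    moreover have "frob_poly U = U" by (rule poly_eqI) (simp add: coeff_frob_poly coeffU)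
    ultimately show ?thesis using that d by (simp add: monic_F2_def frob_poly_add coeffU)
  qed
  have flip: "chi k (h + U) = - chi k h" if h: "h \<in> monic_F2 d" for h
  proof -
    have deg: "Polynomial.degree (h + U) = d" "Polynomial.degree h = d"
      using mem[OF h] h by (auto simp: monic_F2_def)
    \<comment> \<open>Reversal moves the linear term to the exponent \<open>d - 1\<close>. The bound
      on \<open>d\<close> says exactly that this exceeds the index \<open>2 ^ k + 1\<close> read off
      by \<open>char_exp\<close>.\<close>
    have "fps_of_poly (reflect_poly (h + U)) = fps_of_poly (reflect_poly h) + fps_X ^ (d - 1)"
      by (rule fps_ext) (use d in \<open>auto simp: coeff_reflect_poly deg coeffU fps_X_power_iff\<close>)
    hence "fps_nth (log_deriv (fps_of_poly (reflect_poly (h + U)))) (2 ^ k + 1) =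
             fps_nth (log_deriv (fps_of_poly (reflect_poly h))) (2 ^ k + 1)"
      using mem[OF h] h d by (intro log_deriv_cong[where e = "d - 1"]) (auto simp: monic_F2_def)
    moreover have "poly.coeff h 0 = 1" using h by (simp add: monic_F2_def)
    \<comment> \<open>With constant term 1 the sum of the inverse roots is the linear coefficient,
      which \<open>U\<close> raises by 1.\<close>
    ultimately have "char_exp k (h + U) = char_exp k h + 1"
      by (simp add: char_exp_def coeffU add_ac)
    thus ?thesis using char_exp_bit[OF h, of k] by (auto simp: chi_def)
  qed
  have "bij_betw (\<lambda>h. h + U) (monic_F2 d) (monic_F2 d)"
    by (rule bij_betwI[where g = "\<lambda>h. h + U"]) (use mem UU in \<open>auto simp: add.assoc\<close>)
  hence "chi_sum k d = (\<Sum>h\<in>monic_F2 d. chi k (h + U))"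
    unfolding chi_sum_def by (rule sum.reindex_bij_betw[symmetric])
  also have "\<dots> = - chi_sum k d"
    by (simp add: flip chi_sum_def sum_negf)
  finally show ?thesis by simp
qed

section \<open>Explicit character sums for \<open>k = 1\<close>\<close>

text \<open>Newton's identity \<open>p_3 = e_1^3 - 3 e_1 e_2 + 3 e_3\<close> read in characteristic
  two. The index 3 is \<open>2 ^ k + 1\<close> for \<open>k = 1\<close>.\<close>

lemma log_deriv_nth_3:
  assumes "fps_nth R 0 = 1"
  shows "fps_nth (log_deriv R) 3 = fps_nth R 1 ^ 3 + fps_nth R 1 * fps_nth R 2 + fps_nth R 3"
proof -
  define J where "J = inverse R"
  have "R * J = 1" using assms by (simp add: J_def inverse_mult_eq_1')
  hence c: "fps_nth (R * J) n = fps_nth 1 n" for n by simp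
  have J0: "fps_nth J 0 = 1" using assms by (simp add: J_def)
  have J1: "fps_nth J 1 = fps_nth R 1"
    using c[of 1] assms J0 by (simp add: fps_mult_nth ambient_add_eq_0_iff)
  have "fps_nth J 2 + (fps_nth R 1 * fps_nth R 1 + fps_nth R 2) = 0"
    using c[of 2] assms J0 J1 by (simp add: fps_mult_nth numeral_2_eq_2 add_ac)
  hence J2: "fps_nth J 2 = fps_nth R 1 * fps_nth R 1 + fps_nth R 2"
    by (simp only: ambient_add_eq_0_iff)
  have three: "(3 :: ambient) = 1"
    by (metis ambient_two add_0 numeral_3_eq_3 numeral_plus_one semiring_norm(5) add.commute)
  have "fps_nth (log_deriv R) 3 = fps_nth (fps_deriv R * J) 2"
    by (simp add: log_deriv_def J_def[symmetric] mult.assoc numeral_3_eq_3 numeral_2_eq_2)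
  also have "\<dots> = fps_nth R 1 * fps_nth J 2 + 2 * fps_nth R 2 * fps_nth J 1 + 3 * fps_nth R 3 * fps_nth J 0"
    using three by (simp add: fps_mult_nth numeral_2_eq_2 numeral_3_eq_3 add_ac)
  also have "\<dots> = fps_nth R 1 ^ 3 + fps_nth R 1 * fps_nth R 2 + fps_nth R 3"
    by (simp add: J0 J2 three power3_eq_cube distrib_left mult.assoc)
  finally show ?thesis .
qed

lemma char_exp_1_eq:
  assumes "poly.coeff h 0 = 1" "fps_nth (fps_of_poly (reflect_poly h)) 0 = 1"
  shows "char_exp 1 h =
           poly.coeff (reflect_poly h) 1 ^ 3 + poly.coeff (reflect_poly h) 1 * poly.coeff (reflect_poly h) 2 +
           poly.coeff (reflect_poly h) 3 + poly.coeff h 1"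
  using log_deriv_nth_3[OF assms(2)] by (simp add: char_exp_def assms(1))

lemma coeff_bit: "h \<in> monic_F2 d \<Longrightarrow> poly.coeff h i \<in> {0, 1}"
  by (auto simp: monic_F2_def frob_poly_fixed_iff)

text \<open>By \<open>chi_sum_vanish\<close> the sums for \<open>k = 1\<close> vanish from degree 5
  on, so besides degree 0 only the degrees 1 to 4 have to be listed.\<close>

lemma monic_F2_1: "monic_F2 1 = {[:1, 1:]}"
proof (intro equalityI subsetI)
  fix h assume h: "h \<in> monic_F2 1"
  have "h = [:poly.coeff h 0, poly.coeff h 1:]"
    using h by (intro poly_eqI) (auto simp: monic_F2_def coeff_pCons split: nat.splits intro: coeff_eq_0)
  thus "h \<in> {[:1, 1:]}" using h by (simp add: monic_F2_def)
qed (simp add: monic_F2_def frob_poly_pCons)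

lemma monic_F2_2: "monic_F2 2 = (\<lambda>a. [:1, a, 1:]) ` {0, 1}"
proof (intro equalityI subsetI)
  fix h assume h: "h \<in> monic_F2 2"
  have "h = [:poly.coeff h 0, poly.coeff h 1, poly.coeff h 2:]"
    using h by (intro poly_eqI)
      (auto simp: monic_F2_def coeff_pCons numeral_eq_Suc split: nat.splits intro: coeff_eq_0)
  hence "h = [:1, poly.coeff h 1, 1:]" using h by (simp add: monic_F2_def)
  thus "h \<in> (\<lambda>a. [:1, a, 1:]) ` {0, 1}" using coeff_bit[OF h, of 1] by (rule image_eqI)
qed (auto simp: monic_F2_def frob_poly_pCons numeral_eq_Suc)

lemma monic_F2_3: "monic_F2 3 = (\<lambda>(a, b). [:1, b, a, 1:]) ` ({0, 1} \<times> {0, 1})"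
proof (intro equalityI subsetI)
  fix h assume h: "h \<in> monic_F2 3"
  have "h = [:poly.coeff h 0, poly.coeff h 1, poly.coeff h 2, poly.coeff h 3:]"
    using h by (intro poly_eqI)
      (auto simp: monic_F2_def coeff_pCons numeral_eq_Suc split: nat.splits intro: coeff_eq_0)
  hence "h = [:1, poly.coeff h 1, poly.coeff h 2, 1:]" using h by (simp add: monic_F2_def)
  thus "h \<in> (\<lambda>(a, b). [:1, b, a, 1:]) ` ({0, 1} \<times> {0, 1})"
    using coeff_bit[OF h, of 1] coeff_bit[OF h, of 2]
    by (intro image_eqI[where x = "(poly.coeff h 2, poly.coeff h 1)"]) auto
qed (auto simp: monic_F2_def frob_poly_pCons numeral_eq_Suc)

lemma monic_F2_4: "monic_F2 4 = (\<lambda>(a, b, c). [:1, c, b, a, 1:]) ` ({0, 1} \<times> {0, 1} \<times> {0, 1})"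
proof (intro equalityI subsetI)
  fix h assume h: "h \<in> monic_F2 4"
  have "h = [:poly.coeff h 0, poly.coeff h 1, poly.coeff h 2, poly.coeff h 3, poly.coeff h 4:]"
    using h by (intro poly_eqI)
      (auto simp: monic_F2_def coeff_pCons numeral_eq_Suc split: nat.splits intro: coeff_eq_0)
  hence "h = [:1, poly.coeff h 1, poly.coeff h 2, poly.coeff h 3, 1:]" using h by (simp add: monic_F2_def)
  thus "h \<in> (\<lambda>(a, b, c). [:1, c, b, a, 1:]) ` ({0, 1} \<times> {0, 1} \<times> {0, 1})"
    using coeff_bit[OF h, of 1] coeff_bit[OF h, of 2] coeff_bit[OF h, of 3]
    by (intro image_eqI[where x = "(poly.coeff h 3, poly.coeff h 2, poly.coeff h 1)"]) auto
qed (auto simp: monic_F2_def frob_poly_pCons numeral_eq_Suc)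

lemma chi_sum_1_1: "chi_sum 1 1 = 1"
  unfolding chi_sum_def monic_F2_1
  by (simp add: chi_def char_exp_1_eq[unfolded One_nat_def] reflect_poly_def numeral_eq_Suc)

lemma chi_sum_1_2: "chi_sum 1 2 = 0"
  unfolding chi_sum_def monic_F2_2
  by (subst sum.reindex)
     (auto simp: inj_on_def chi_def char_exp_1_eq[unfolded One_nat_def] reflect_poly_def numeral_eq_Suc)

lemma chi_sum_1_3: "chi_sum 1 3 = 2"
  unfolding chi_sum_def monic_F2_3
  by (subst sum.reindex)
     (auto simp: inj_on_def chi_def char_exp_1_eq[unfolded One_nat_def] reflect_poly_def numeral_eq_Suc
        sum.cartesian_product')

lemma chi_sum_1_4: "chi_sum 1 4 = 4"
  unfolding chi_sum_def monic_F2_4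
  by (subst sum.reindex)
     (auto simp: inj_on_def chi_def char_exp_1_eq[unfolded One_nat_def] reflect_poly_def numeral_eq_Suc
        sum.cartesian_product')

section \<open>Valuation rings\<close>

text \<open>Negation is the identity in characteristic two, so closure under negatives is
  automatic.\<close>

lemma subring_ambient_iff:
  "subring V ambient_ring \<longleftrightarrow> 1 \<in> V \<and> (\<forall>a\<in>V. \<forall>b\<in>V. a + b \<in> V \<and> a * b \<in> V)"
proof -
  interpret R: cring ambient_ring by (rule cring_from_type_algebra)
  have minus: "\<ominus>\<^bsub>ambient_ring\<^esub> a = a" for a
    by (rule R.minus_equality) (simp_all add: ring_of_type_algebra_def)
  have subringD: "1 \<in> V \<and> (\<forall>a\<in>V. \<forall>b\<in>V. a + b \<in> V \<and> a * b \<in> V)" if "subring V ambient_ring"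
    using subringE(3,6,7)[OF that] by (simp add: ring_of_type_algebra_def)
  have subringI: "subring V ambient_ring" if "1 \<in> V \<and> (\<forall>a\<in>V. \<forall>b\<in>V. a + b \<in> V \<and> a * b \<in> V)"
    by (rule R.subringI) (use that in \<open>auto simp: minus, auto simp: ring_of_type_algebra_def\<close>)
  show ?thesis using subringD subringI by blast
qed

text \<open>Translates the generated field of the ring record into closure under the type class
  operations. The convention \<open>inverse 0 = 0\<close> spares a side condition on
  inverses.\<close>

lemma generate_field_ambient:
  assumes "1 \<in> E" "H \<subseteq> E" "\<And>a b. a \<in> E \<Longrightarrow> b \<in> E \<Longrightarrow> a + b \<in> E"
    "\<And>a b. a \<in> E \<Longrightarrow> b \<in> E \<Longrightarrow> a * b \<in> E" "\<And>a. a \<in> E \<Longrightarrow> inverse a \<in> E"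
  shows "generate_field ambient_ring H \<subseteq> E"
proof -
  interpret R: cring ambient_ring by (rule cring_from_type_algebra)
  have minus: "\<ominus>\<^bsub>ambient_ring\<^esub> a = a" for a
    by (rule R.minus_equality) (simp_all add: ring_of_type_algebra_def)
  have inv: "inv\<^bsub>ambient_ring\<^esub> a = inverse a" if "a \<noteq> 0" for a
    by (rule R.comm_inv_char) (use that in \<open>simp_all add: ring_of_type_algebra_def\<close>)
  have "a \<in> E" if "a \<in> generate_field ambient_ring H" for a
    using that
  proof induction
    case (m_inv h)
    thus ?case using inv[of h] assms(5) by (simp add: ring_of_type_algebra_def)
  qed (use assms minus in \<open>auto simp: ring_of_type_algebra_def\<close>)
  thus ?thesis by blast
qed

lemma generate_field_closed:
  fixes H defines "E \<equiv> generate_field ambient_ring H"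
  shows "0 \<in> E" "1 \<in> E" "H \<subseteq> E" "a \<in> E \<Longrightarrow> b \<in> E \<Longrightarrow> a + b \<in> E" "a \<in> E \<Longrightarrow> b \<in> E \<Longrightarrow> a * b \<in> E"
    "a \<in> E \<Longrightarrow> inverse a \<in> E"
proof -
  interpret R: cring ambient_ring by (rule cring_from_type_algebra)
  have inv: "inv\<^bsub>ambient_ring\<^esub> a = inverse a" if "a \<noteq> 0" for a
    by (rule R.comm_inv_char) (use that in \<open>simp_all add: ring_of_type_algebra_def\<close>)
  show one: "1 \<in> E"
    using generate_field.one[of ambient_ring H] by (simp add: E_def ring_of_type_algebra_def)
  show "H \<subseteq> E" by (auto simp: E_def intro: generate_field.incl)
  show add: "a + b \<in> E" if "a \<in> E" "b \<in> E" for a b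
    using generate_field.eng_add[of a ambient_ring H b] that by (simp add: E_def ring_of_type_algebra_def)
  show "a \<in> E \<Longrightarrow> b \<in> E \<Longrightarrow> a * b \<in> E"
    using generate_field.eng_mult[of a ambient_ring H b] by (simp add: E_def ring_of_type_algebra_def)
  show zero: "0 \<in> E" using add[OF one one] by simp
  show "a \<in> E \<Longrightarrow> inverse a \<in> E"
  proof (cases "a = 0")
    case False
    thus "a \<in> E \<Longrightarrow> inverse a \<in> E"
      using generate_field.m_inv[of a ambient_ring H] inv[OF False]
      by (simp add: E_def ring_of_type_algebra_def)
  qed (use zero in simp)
qed

text \<open>\<open>valuation_ring\<close> treats \<open>K\<close> as a mere set; the closure
  assumptions supply the quotients that are compared in \<open>M_add\<close>.\<close>

locale valuation =
  fixes n :: nat and K V :: "ambient set"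
  assumes V: "valuation_ring (F2pow n) K V"
    and K_closed: "a \<in> K \<Longrightarrow> b \<in> K \<Longrightarrow> a * b \<in> K" "a \<in> K \<Longrightarrow> inverse a \<in> K"
begin

abbreviation "M \<equiv> maximal_ideal_of V"

lemma V_1: "1 \<in> V" and V_add: "a \<in> V \<Longrightarrow> b \<in> V \<Longrightarrow> a + b \<in> V"
  and V_mult: "a \<in> V \<Longrightarrow> b \<in> V \<Longrightarrow> a * b \<in> V" and V_const: "c \<in> F2pow n \<Longrightarrow> c \<in> V"
  and V_K: "a \<in> V \<Longrightarrow> a \<in> K" and V_total: "a \<in> K \<Longrightarrow> a \<in> V \<or> inverse a \<in> V"
  using V unfolding valuation_ring_def subring_ambient_iff by auto

lemma V_0: "0 \<in> V" using V_const[of 0] by simp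

lemma V_power: "a \<in> V \<Longrightarrow> a ^ i \<in> V"
  by (induction i) (auto intro: V_1 V_mult)

lemma M_V: "a \<in> M \<Longrightarrow> a \<in> V" by (simp add: maximal_ideal_of_def)

lemma M_0: "0 \<in> M" using V_0 by (simp add: maximal_ideal_of_def)

lemma M_mult:
  assumes "a \<in> M" "b \<in> V"
  shows "a * b \<in> M"
proof (rule ccontr)
  assume "a * b \<notin> M"
  moreover have "a * b \<in> V" using assms M_V V_mult by blast
  ultimately have "a * b \<noteq> 0" "inverse (a * b) \<in> V" by (auto simp: maximal_ideal_of_def)
  hence "a \<noteq> 0" "b * inverse (a * b) \<in> V" using assms V_mult by auto
  moreover from this have "b * inverse (a * b) = inverse a"
    using \<open>a * b \<noteq> 0\<close> by (simp add: field_simps)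
  ultimately have "a \<noteq> 0" "inverse a \<in> V" by metis+
  thus False using assms(1) by (simp add: maximal_ideal_of_def)
qed

text \<open>One of \<open>a / b\<close> and \<open>b / a\<close> lies in \<open>V\<close>, so
  \<open>a + b\<close> is a multiple of \<open>b\<close> or of \<open>a\<close> by an element of
  \<open>V\<close>.\<close>

lemma M_add:
  assumes "a \<in> M" "b \<in> M"
  shows "a + b \<in> M"
proof (cases "a = 0 \<or> b = 0")
  case False
  have ab: "a * inverse b \<in> V \<or> b * inverse a \<in> V"
  proof -
    have "a * inverse b \<in> K" using assms M_V V_K K_closed by blast
    moreover have "inverse (a * inverse b) = b * inverse a" by (simp add: mult.commute)
    ultimately show ?thesis using V_total[of "a * inverse b"] by (simp only:)
  qed
  thus ?thesis
  proof
    assume "a * inverse b \<in> V"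
    hence "b * (a * inverse b + 1) \<in> M" using assms M_mult V_add V_1 by blast
    also have "b * (a * inverse b + 1) = a + b" using False by (simp add: distrib_left)
    finally show ?thesis .
  next
    assume "b * inverse a \<in> V"
    hence "a * (b * inverse a + 1) \<in> M" using assms M_mult V_add V_1 by blast
    also have "a * (b * inverse a + 1) = a + b" using False by (simp add: distrib_left)
    finally show ?thesis .
  qed
qed (use assms in auto)

lemma const_in_M: "c \<in> F2pow n \<Longrightarrow> c \<in> M \<Longrightarrow> c = 0"
  using V_const[OF F2pow_inverse] by (auto simp: maximal_ideal_of_def)

text \<open>The residue map as a relation: it makes sense before residues are known to exist, and it
  already entails \<open>u \<in> V\<close>, see \<open>res_V\<close>.\<close>

definition res :: "ambient \<Rightarrow> ambient \<Rightarrow> bool" where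
  "res u c \<longleftrightarrow> c \<in> F2pow n \<and> u + c \<in> M"

lemma res_V: "res u c \<Longrightarrow> u \<in> V"
  using V_add[OF M_V V_const, of "u + c" c] by (simp add: res_def add.assoc)

lemma res_const: "c \<in> F2pow n \<Longrightarrow> res c c"
  by (simp add: res_def M_0)

lemma res_add: "res u c \<Longrightarrow> res v d \<Longrightarrow> res (u + v) (c + d)"
  using M_add[of "u + c" "v + d"] by (simp add: res_def F2pow_add add_ac)

lemma res_mult:
  assumes "res u c" "res v d"
  shows "res (u * v) (c * d)"
proof -
  have "(u + c) * v + (v + d) * c \<in> M"
    using assms V_const[of c] res_V[of v d] by (intro M_add[OF M_mult M_mult]) (auto simp: res_def)
  also have "(u + c) * v + (v + d) * c = u * v + c * d + (c * v + c * v)"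
    by (simp only: distrib_left distrib_right mult_ac add_ac)
  finally show ?thesis using assms by (simp add: res_def F2pow_mult)
qed

lemma res_power: "res u c \<Longrightarrow> res (u ^ i) (c ^ i)"
  by (induction i) (auto intro: res_mult res_const)

lemma res_poly:
  assumes "res u c" "\<And>i. poly.coeff A i \<in> F2pow n"
  shows "res (poly A u) (poly A c)"
  using assms(2)
proof (induction A)
  case (pCons a A)
  have "a \<in> F2pow n" using pCons.prems[of 0] by simp
  moreover have "poly.coeff A i \<in> F2pow n" for i using pCons.prems[of "Suc i"] by simp
  ultimately show ?case using pCons.IH assms(1) by (auto intro!: res_add res_mult res_const)
qed (auto intro: res_const)

lemma res_unique: "res u c \<Longrightarrow> res u d \<Longrightarrow> c = d"
proof -
  assume "res u c" "res u d"
  hence "res (u + u) (c + d)" by (rule res_add)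
  hence "c + d = 0" using const_in_M[of "c + d"] by (simp add: res_def)
  thus "c = d" by (simp add: ambient_add_eq_0_iff)
qed

end

text \<open>Models the coordinate ring \<open>R\<close> of an affine curve with function field
  \<open>K\<close>, the evaluation \<open>e\<close> at a rational point and a local parameter
  \<open>t\<close> there. In \<open>uniformizer\<close> every nonzero function is a power of
  \<open>t\<close> times a quotient of functions that do not vanish at the point, which stands in
  for an order function.\<close>

locale local_ring =
  fixes n :: nat and K R :: "ambient set" and e :: "ambient \<Rightarrow> ambient" and t :: ambient
  assumes R_const: "c \<in> F2pow n \<Longrightarrow> c \<in> R"
    and R_add: "a \<in> R \<Longrightarrow> b \<in> R \<Longrightarrow> a + b \<in> R"
    and R_mult: "a \<in> R \<Longrightarrow> b \<in> R \<Longrightarrow> a * b \<in> R"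
    and e_F: "a \<in> R \<Longrightarrow> e a \<in> F2pow n"
    and e_const: "c \<in> F2pow n \<Longrightarrow> e c = c"
    and e_add: "a \<in> R \<Longrightarrow> b \<in> R \<Longrightarrow> e (a + b) = e a + e b"
    and e_mult: "a \<in> R \<Longrightarrow> b \<in> R \<Longrightarrow> e (a * b) = e a * e b"
    and K_def: "K = {a / b | a b. a \<in> R \<and> b \<in> R \<and> b \<noteq> 0}"
    and t: "t \<in> R" "t \<noteq> 0" "e t = 0"
    and uniformizer: "a \<in> R \<Longrightarrow> a \<noteq> 0 \<Longrightarrow>
      \<exists>i b c. b \<in> R \<and> c \<in> R \<and> e b \<noteq> 0 \<and> e c \<noteq> 0 \<and> a * b = t ^ i * c"
begin

text \<open>The localisation of \<open>R\<close> at the kernel of \<open>e\<close>, that is, the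
  local ring of the point.\<close>

definition W :: "ambient set" where
  "W = {a / b | a b. a \<in> R \<and> b \<in> R \<and> e b \<noteq> 0}"

lemma e_0: "e 0 = 0" and R_0: "0 \<in> R" and e_1: "e 1 = 1" and R_1: "1 \<in> R"
  using e_const[of 0] e_const[of 1] R_const[of 0] R_const[of 1] by auto

lemma nonzero: "e b \<noteq> 0 \<Longrightarrow> b \<noteq> 0"
  using e_0 by auto

lemma WI: "a \<in> R \<Longrightarrow> b \<in> R \<Longrightarrow> e b \<noteq> 0 \<Longrightarrow> a / b \<in> W"
  unfolding W_def by blast

lemma WE: "u \<in> W \<Longrightarrow> (\<And>a b. a \<in> R \<Longrightarrow> b \<in> R \<Longrightarrow> e b \<noteq> 0 \<Longrightarrow> u = a / b \<Longrightarrow> thesis) \<Longrightarrow> thesis"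
  unfolding W_def by blast

lemma R_W: "a \<in> R \<Longrightarrow> a \<in> W"
  using WI[of a 1] R_1 e_1 by simp

lemma W_add: "u \<in> W \<Longrightarrow> v \<in> W \<Longrightarrow> u + v \<in> W"
proof (elim WE)
  fix a b c d assume *: "a \<in> R" "b \<in> R" "e b \<noteq> 0" "u = a / b" "c \<in> R" "d \<in> R" "e d \<noteq> 0" "v = c / d"
  have "(a * d + c * b) / (b * d) \<in> W"
    using * by (intro WI R_add R_mult) (auto simp: e_mult)
  also have "(a * d + c * b) / (b * d) = u + v"
    using * nonzero[of b] nonzero[of d] by (simp add: add_frac_eq)
  finally show ?thesis .
qed

lemma W_mult: "u \<in> W \<Longrightarrow> v \<in> W \<Longrightarrow> u * v \<in> W"
proof (elim WE)
  fix a b c d assume *: "a \<in> R" "b \<in> R" "e b \<noteq> 0" "u = a / b" "c \<in> R" "d \<in> R" "e d \<noteq> 0" "v = c / d"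
  have "(a * c) / (b * d) \<in> W"
    using * by (intro WI R_mult) (auto simp: e_mult)
  thus ?thesis using * by simp
qed

lemma t_power_W: "t ^ i \<in> W"
  by (induction i) (auto intro: W_mult R_W R_1 t)

text \<open>Numerator and denominator are powers of \<open>t\<close> up to units of
  \<open>W\<close>; comparing the exponents decides which of \<open>u\<close> and
  \<open>inverse u\<close> lies in \<open>W\<close>.\<close>

lemma W_total:
  assumes "u \<in> K"
  shows "u \<in> W \<or> inverse u \<in> W"
proof (cases "u = 0")
  case True
  thus ?thesis using R_W[OF R_0] by simp
next
  case False
  obtain a b where ab: "a \<in> R" "b \<in> R" "b \<noteq> 0" "u = a / b" using assms unfolding K_def by blast
  have "a \<noteq> 0" using False ab by auto
  obtain i c d where a: "c \<in> R" "d \<in> R" "e c \<noteq> 0" "e d \<noteq> 0" "a * c = t ^ i * d"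
    using uniformizer[OF ab(1) \<open>a \<noteq> 0\<close>] by blast
  obtain j f g where b: "f \<in> R" "g \<in> R" "e f \<noteq> 0" "e g \<noteq> 0" "b * f = t ^ j * g"
    using uniformizer[OF ab(2,3)] by blast
  have nz: "c \<noteq> 0" "d \<noteq> 0" "f \<noteq> 0" "g \<noteq> 0" using a b nonzero by auto
  have a': "a = t ^ i * d / c" and b': "b = t ^ j * g / f"
    using a(5) b(5) nz by (simp_all add: nonzero_eq_divide_eq)
  have unit: "(d * f) / (c * g) \<in> W" "(c * g) / (d * f) \<in> W"
    using a b by (auto intro!: WI R_mult simp: e_mult)
  show ?thesis
  proof (cases "j \<le> i")
    case True
    hence "t ^ i = t ^ j * t ^ (i - j)" by (simp flip: power_add)
    hence "u = t ^ (i - j) * ((d * f) / (c * g))"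
      using t(2) nz by (simp add: ab(4) a' b')
    thus ?thesis using W_mult[OF t_power_W unit(1)] by simp
  next
    case False
    hence "t ^ j = t ^ i * t ^ (j - i)" by (simp flip: power_add)
    hence "inverse u = t ^ (j - i) * ((c * g) / (d * f))"
      using t(2) nz by (simp add: ab(4) a' b')
    thus ?thesis using W_mult[OF t_power_W unit(2)] by simp
  qed
qed

lemma W_subset_K: "W \<subseteq> K"
  unfolding W_def K_def using nonzero by blast

lemma nonunit:
  assumes "a \<in> R" "b \<in> R" "e b \<noteq> 0" "e a = 0"
  shows "a / b \<in> maximal_ideal_of W"
proof -
  have "inverse (a / b) \<notin> W" if "a \<noteq> 0"
  proof
    assume "inverse (a / b) \<in> W"
    then obtain c d where cd: "c \<in> R" "d \<in> R" "e d \<noteq> 0" "b / a = c / d" by (auto elim: WE)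
    hence "b * d = c * a" using that nonzero[of d] by (simp add: frac_eq_eq)
    hence "e b * e d = e c * e a" using cd assms by (metis e_mult)
    thus False using assms cd by simp
  qed
  thus ?thesis using WI[OF assms(1-3)] by (auto simp: maximal_ideal_of_def)
qed

lemma valuation_ring_W: "valuation_ring (F2pow n) K W"
proof -
  have "F2pow n \<subseteq> W" using R_W R_const by blast
  moreover have "t \<in> W" using R_W t by blast
  \<comment> \<open>\<open>t\<close> and \<open>inverse t\<close> witness that the inclusions of
    \<open>F2pow n\<close> in \<open>W\<close> and of \<open>W\<close> in \<open>K\<close> are
    strict.\<close>
  moreover have "t \<notin> F2pow n" using e_const t by metis
  moreover have "inverse t \<in> K" unfolding K_def inverse_eq_divide using R_1 t by blast
  moreover have "inverse t \<notin> W"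
    using nonunit[of t 1] t R_1 e_1 by (simp add: maximal_ideal_of_def)
  ultimately show ?thesis
    unfolding valuation_ring_def subring_ambient_iff
    using W_subset_K W_total W_add W_mult R_W[OF R_1] by blast
qed

lemma rational_place_W: "W \<in> rational_places (F2pow n) K"
proof -
  have "\<exists>c\<in>F2pow n. u - c \<in> maximal_ideal_of W" if "u \<in> W" for u
    using that
  proof (rule WE)
    fix a b assume *: "a \<in> R" "b \<in> R" "e b \<noteq> 0" "u = a / b"
    define c where "c = e a * inverse (e b)"
    have c: "c \<in> F2pow n" using * by (auto simp: c_def intro: F2pow_mult F2pow_inverse e_F)
    have cb: "c * b \<in> R" using * c R_mult R_const by blast
    moreover have "e (a + c * b) = 0"
      using * c cb by (simp add: e_add e_mult R_const e_const) (simp add: c_def mult.assoc)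
    ultimately have "(a + c * b) / b \<in> maximal_ideal_of W"
      using * by (intro nonunit R_add) auto
    also have "(a + c * b) / b = u - c"
      using * nonzero[of b] by (simp add: add_divide_distrib)
    finally show ?thesis using c by blast
  qed
  thus ?thesis using valuation_ring_W by (auto simp: rational_places_def)
qed

lemma residue_W: "a \<in> R \<Longrightarrow> a + e a \<in> maximal_ideal_of W"
  using nonunit[of "a + e a" 1] R_1 e_1 by (simp add: R_add R_const e_F e_add e_const)

lemma K_mult: "u \<in> K \<Longrightarrow> v \<in> K \<Longrightarrow> u * v \<in> K"
proof -
  assume "u \<in> K" "v \<in> K"
  then obtain a b c d where *: "a \<in> R" "b \<in> R" "b \<noteq> 0" "u = a / b" "c \<in> R" "d \<in> R" "d \<noteq> 0" "v = c / d"
    unfolding K_def by blast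
  hence "u * v = (a * c) / (b * d)" "a * c \<in> R" "b * d \<in> R" "b * d \<noteq> 0" using R_mult by auto
  thus ?thesis unfolding K_def by blast
qed

lemma K_inverse: "u \<in> K \<Longrightarrow> inverse u \<in> K"
proof -
  assume "u \<in> K"
  then obtain a b where *: "a \<in> R" "b \<in> R" "b \<noteq> 0" "u = a / b"
    unfolding K_def by blast
  show ?thesis
  proof (cases "a = 0")
    case True
    thus ?thesis using * \<open>u \<in> K\<close> by simp
  next
    case False
    hence "inverse u = b / a" using * by simp
    thus ?thesis using * False unfolding K_def by blast
  qed
qed

text \<open>Valuation rings are maximal with respect to domination.\<close>

lemma W_unique:
  assumes V: "valuation_ring (F2pow n) K V" and dom: "\<And>a. a \<in> R \<Longrightarrow> a + e a \<in> maximal_ideal_of V"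
  shows "V = W"
proof -
  interpret valuation n K V by standard (use V K_mult K_inverse in auto)
  have R_V: "a \<in> V" if "a \<in> R" for a
    using V_add[OF M_V[OF dom[OF that]] V_const[OF e_F[OF that]]] by (simp add: add.assoc)
  have inv_V: "inverse b \<in> V" if b: "b \<in> R" "e b \<noteq> 0" for b
  proof (rule ccontr)
    assume "inverse b \<notin> V"
    hence "b \<in> M" using R_V[OF b(1)] by (simp add: maximal_ideal_of_def)
    hence "b + (b + e b) \<in> M" by (rule M_add[OF _ dom[OF b(1)]])
    thus False using const_in_M[OF e_F[OF b(1)]] b(2) by simp
  qed
  show ?thesis
  proof (intro equalityI subsetI)
    fix u assume "u \<in> W"
    thus "u \<in> V" by (rule WE) (simp add: divide_inverse V_mult R_V inv_V)
  next
    fix u assume u: "u \<in> V"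
    show "u \<in> W"
    proof (rule ccontr)
      assume nW: "u \<notin> W"
      hence "inverse u \<in> W" using W_total[OF V_K[OF u]] by blast
      then obtain a b where ab: "a \<in> R" "b \<in> R" "e b \<noteq> 0" "inverse u = a / b" by (rule WE)
      have "u = b / a" using arg_cong[OF ab(4), of inverse] by simp
      \<comment> \<open>A nonzero value \<open>e a\<close> would put \<open>u = b / a\<close> into
        \<open>W\<close>, and so would \<open>a = 0\<close>, which means
        \<open>u = 0\<close>.\<close>
      hence a: "e a = 0" "a \<noteq> 0" using WI[of b a] ab nW R_W[OF R_0] by auto
      have "a \<in> M" using dom[OF ab(1)] a by simp
      moreover have "inverse a = u * inverse b"
        using \<open>u = b / a\<close> nonzero[OF ab(3)] a(2) by (simp add: field_simps)
      hence "inverse a \<in> V" using V_mult[OF u inv_V[OF ab(2,3)]] by simp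
      ultimately show False using a(2) by (simp add: maximal_ideal_of_def)
    qed
  qed
qed

end

section \<open>The local rings of the curve \<open>w\<^sup>2 + s\<^sup>m w = s + s\<^sup>r\<^sup>+\<^sup>1\<close>\<close>

definition F2pow_poly :: "nat \<Rightarrow> ambient poly set" where
  "F2pow_poly n = {A. \<forall>i. poly.coeff A i \<in> F2pow n}"

lemma F2pow_poly_0: "0 \<in> F2pow_poly n"
  by (simp add: F2pow_poly_def)

lemma F2pow_poly_pCons: "pCons a A \<in> F2pow_poly n \<longleftrightarrow> a \<in> F2pow n \<and> A \<in> F2pow_poly n"
  by (auto simp: F2pow_poly_def coeff_pCons split: nat.splits)

lemma F2pow_poly_const: "a \<in> F2pow n \<Longrightarrow> [:a:] \<in> F2pow_poly n"
  by (simp add: F2pow_poly_pCons F2pow_poly_0)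

lemma F2pow_poly_add: "A \<in> F2pow_poly n \<Longrightarrow> B \<in> F2pow_poly n \<Longrightarrow> A + B \<in> F2pow_poly n"
  by (simp add: F2pow_poly_def F2pow_add)

lemma F2pow_poly_mult: "A \<in> F2pow_poly n \<Longrightarrow> B \<in> F2pow_poly n \<Longrightarrow> A * B \<in> F2pow_poly n"
  by (auto simp: F2pow_poly_def coeff_mult intro!: F2pow_sum F2pow_mult)

lemma F2pow_poly_smult: "a \<in> F2pow n \<Longrightarrow> A \<in> F2pow_poly n \<Longrightarrow> Polynomial.smult a A \<in> F2pow_poly n"
  by (simp add: F2pow_poly_def F2pow_mult)

lemma F2pow_poly_monom: "a \<in> F2pow n \<Longrightarrow> Polynomial.monom a i \<in> F2pow_poly n"
  by (simp add: F2pow_poly_def)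

lemma F2pow_poly_eval: "A \<in> F2pow_poly n \<Longrightarrow> c \<in> F2pow n \<Longrightarrow> poly A c \<in> F2pow n"
  by (induction A) (auto simp: F2pow_poly_pCons intro: F2pow_add F2pow_mult)

lemma F2pow_poly_root:
  assumes "A \<in> F2pow_poly n" "c \<in> F2pow n" "poly A c = 0"
  obtains A' where "A' \<in> F2pow_poly n" "A = [:c, 1:] * A'" "A \<noteq> 0 \<Longrightarrow> Polynomial.degree A' < Polynomial.degree A"
proof -
  have "synthetic_div A c \<in> F2pow_poly n"
    using assms(1) by (induction A) (auto simp: F2pow_poly_0 F2pow_poly_pCons intro: F2pow_poly_eval assms(2))
  moreover have eq: "A = [:c, 1:] * synthetic_div A c"
    using synthetic_div_correct'[of c A] assms(3) by (simp del: mult_pCons_left)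
  moreover have "Polynomial.degree (synthetic_div A c) < Polynomial.degree A" if "A \<noteq> 0"
  proof -
    have "synthetic_div A c \<noteq> 0" using that eq by auto
    hence "Polynomial.degree ([:c, 1:] * synthetic_div A c) = 1 + Polynomial.degree (synthetic_div A c)"
      by (subst degree_mult_eq) auto
    thus ?thesis using eq by simp
  qed
  ultimately show ?thesis using that by blast
qed

lemma F2pow_poly_root_power:
  assumes "A \<in> F2pow_poly n" "c \<in> F2pow n" "A \<noteq> 0"
  shows "\<exists>j A'. A' \<in> F2pow_poly n \<and> A = [:c, 1:] ^ j * A' \<and> poly A' c \<noteq> 0"
  using assms(1,3)
proof (induction "Polynomial.degree A" arbitrary: A rule: less_induct)
  case less
  show ?case
  proof (cases "poly A c = 0")
    case True
    then obtain B where B: "B \<in> F2pow_poly n" "A = [:c, 1:] * B" "Polynomial.degree B < Polynomial.degree A"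
      using F2pow_poly_root[OF less.prems(1) assms(2)] less.prems(2) by blast
    have "B \<noteq> 0" using B less.prems by auto
    then obtain j A' where "A' \<in> F2pow_poly n" "B = [:c, 1:] ^ j * A'" "poly A' c \<noteq> 0"
      using less.hyps[OF B(3,1)] by blast
    thus ?thesis using B(2) by (intro exI[of _ "Suc j"] exI[of _ A']) (simp only: power_Suc mult.assoc simp_thms)
  next
    case False
    thus ?thesis using less.prems by (intro exI[of _ 0] exI[of _ A]) simp
  qed
qed

text \<open>The common shape of both charts. The derivative of the equation with respect to
  \<open>w\<close> is \<open>s^m\<close>, so where \<open>s = c\<close> is nonzero the curve is
  smooth with local parameter \<open>s + c\<close>. At \<open>s = 0\<close> also
  \<open>w = 0\<close>, and the linear term \<open>s\<close> makes the curve smooth there with local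
  parameter \<open>w\<close>.\<close>

locale curve =
  fixes n m r :: nat and s w :: ambient
  assumes transcendental: "A \<in> F2pow_poly n \<Longrightarrow> poly A s = 0 \<Longrightarrow> A = 0"
    and curve_eq: "w ^ 2 + s ^ m * w = s + s ^ (r + 1)"
    and m: "m \<ge> 1" and r: "r \<ge> 1"
begin

definition \<alpha> :: "ambient poly" where "\<alpha> = Polynomial.monom 1 m"
definition \<beta> :: "ambient poly" where "\<beta> = Polynomial.monom 1 1 + Polynomial.monom 1 (r + 1)"

lemma \<alpha>_F: "\<alpha> \<in> F2pow_poly n" and \<beta>_F: "\<beta> \<in> F2pow_poly n"
  by (auto simp: \<alpha>_def \<beta>_def intro!: F2pow_poly_add F2pow_poly_monom)

lemma poly_\<alpha>: "poly \<alpha> u = u ^ m" and poly_\<beta>: "poly \<beta> u = u + u ^ (r + 1)"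
  by (simp_all add: \<alpha>_def \<beta>_def poly_monom)

lemma w_sq: "w ^ 2 = poly \<beta> s + poly \<alpha> s * w"
  using curve_eq ambient_add_cancel[of "poly \<alpha> s * w" "w ^ 2"]
  by (simp add: poly_\<alpha> poly_\<beta> add_ac)

text \<open>Coordinates with respect to the basis \<open>1, w\<close> of the coordinate ring over
  the polynomials in \<open>s\<close>; \<open>w_sq\<close> reduces products, and
  \<open>ev_eq_0\<close> gives uniqueness.\<close>

definition ev :: "ambient poly \<Rightarrow> ambient poly \<Rightarrow> ambient" where
  "ev A B = poly A s + poly B s * w"

lemma ev_add: "ev A B + ev A' B' = ev (A + A') (B + B')"
  by (simp add: ev_def algebra_simps)

lemma ev_mult: "ev A B * ev A' B' = ev (A * A' + B * B' * \<beta>) (A * B' + B * A' + B * B' * \<alpha>)"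
proof -
  have "ev A B * ev A' B' = poly (A * A') s + (poly (A * B') s + poly (B * A') s) * w + poly (B * B') s * w ^ 2"
    by (simp add: ev_def algebra_simps power2_eq_square)
  thus ?thesis by (simp add: ev_def w_sq algebra_simps)
qed

text \<open>Infinite descent at the ramified point \<open>s = 0\<close>.\<close>

lemma norm_form_anisotropic:
  "A ^ 2 + \<alpha> * A * B = B ^ 2 * \<beta> \<Longrightarrow> B = 0"
proof (induction "Polynomial.degree B" arbitrary: A B rule: less_induct)
  case less
  define U :: "ambient poly" where "U = [:0, 1:]"
  have U: "U \<noteq> 0" by (simp add: U_def)
  define \<alpha>' where "\<alpha>' = (Polynomial.monom 1 (m - 1) :: ambient poly)"
  define \<beta>' where "\<beta>' = 1 + (Polynomial.monom 1 r :: ambient poly)"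
  have \<alpha>': "\<alpha> = U * \<alpha>'" using m by (simp add: \<alpha>_def \<alpha>'_def U_def flip: monom_Suc)
  have \<beta>': "\<beta> = U * \<beta>'"
    by (simp add: \<beta>_def \<beta>'_def U_def distrib_left monom_Suc monom_0 one_pCons)
  have root: "\<exists>A'. C = U * A'" if "poly C 0 = 0" for C
    using that by (simp add: U_def poly_eq_0_iff_dvd dvd_def)
  have U0: "poly U 0 = 0" by (simp add: U_def)
  \<comment> \<open>Both \<alpha> and \<beta> vanish at 0, and \<beta> only to first order because
    \<open>\<beta>'\<close> has the value 1 there. So \<open>U\<close> divides \<open>A\<close> and,
    after one division by \<open>U\<close>, also \<open>B\<close>.\<close>
  have "poly (A ^ 2 + \<alpha> * A * B) 0 = poly (B ^ 2 * \<beta>) 0" using less.prems by simp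
  hence "poly A 0 = 0" by (simp add: \<alpha>' \<beta>' U0)
  then obtain A1 where A1: "A = U * A1" using root by blast
  have eq1: "U * A1 ^ 2 + U * \<alpha>' * A1 * B = B ^ 2 * \<beta>'"
  proof -
    have "U * (U * A1 ^ 2 + U * \<alpha>' * A1 * B) = A ^ 2 + \<alpha> * A * B"
      unfolding A1 \<alpha>' by (simp only: power2_eq_square distrib_left mult_ac)
    also have "\<dots> = U * (B ^ 2 * \<beta>')" using less.prems by (simp only: \<beta>' mult_ac)
    finally show ?thesis using U by simp
  qed
  have "poly (U * A1 ^ 2 + U * \<alpha>' * A1 * B) 0 = poly (B ^ 2 * \<beta>') 0" using eq1 by simp
  hence "poly B 0 = 0" using r by (simp add: U0 \<beta>'_def poly_monom power_0_left)
  then obtain B1 where B1: "B = U * B1" using root by blast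
  have "A1 ^ 2 + \<alpha> * A1 * B1 = B1 ^ 2 * \<beta>"
  proof -
    have "U * (A1 ^ 2 + \<alpha> * A1 * B1) = U * A1 ^ 2 + U * \<alpha>' * A1 * B"
      unfolding B1 \<alpha>' by (simp only: power2_eq_square distrib_left mult_ac)
    also have "\<dots> = B ^ 2 * \<beta>'" by (rule eq1)
    also have "\<dots> = U * (B1 ^ 2 * \<beta>)" unfolding B1 \<beta>' by (simp only: power2_eq_square mult_ac)
    finally show ?thesis using U by simp
  qed
  moreover have "Polynomial.degree B1 < Polynomial.degree B" if "B1 \<noteq> 0"
    using that U degree_mult_eq[of U B1] by (simp add: B1 U_def del: mult_pCons_left)
  ultimately show ?case using less.hyps[of B1 A1] B1 by (cases "B1 = 0") auto
qed

text \<open>A relation \<open>A + B w = 0\<close> makes the norm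
  \<open>A^2 + \<alpha> A B + \<beta> B^2\<close> vanish at the transcendental \<open>s\<close>,
  hence identically, and the norm form is anisotropic. In other words, the quadratic equation of
  \<open>w\<close> is irreducible over the rational functions in \<open>s\<close>.\<close>

lemma ev_eq_0:
  assumes "A \<in> F2pow_poly n" "B \<in> F2pow_poly n" "ev A B = 0"
  shows "A = 0" "B = 0"
proof -
  have As: "poly A s = poly B s * w" using assms(3) by (simp add: ev_def ambient_add_eq_0_iff)
  have "poly (A ^ 2 + \<alpha> * A * B + B ^ 2 * \<beta>) s = poly B s ^ 2 * (w ^ 2 + (poly \<beta> s + poly \<alpha> s * w))"
    by (simp add: As algebra_simps power2_eq_square)
  also have "\<dots> = 0" unfolding w_sq by simp
  finally have "A ^ 2 + \<alpha> * A * B + B ^ 2 * \<beta> = 0"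
    by (intro transcendental)
       (auto simp: power2_eq_square intro!: F2pow_poly_add F2pow_poly_mult assms \<alpha>_F \<beta>_F)
  hence "A ^ 2 + \<alpha> * A * B = B ^ 2 * \<beta>"
  proof -
    have neg: "- P = P" for P :: "ambient poly" by (rule poly_eqI) simp
    assume "A ^ 2 + \<alpha> * A * B + B ^ 2 * \<beta> = 0"
    thus ?thesis by (metis add_eq_0_iff2 neg)
  qed
  thus "B = 0" by (rule norm_form_anisotropic)
  thus "A = 0" using assms by (intro transcendental) (auto simp: ev_def)
qed

definition R :: "ambient set" where
  "R = {ev A B | A B. A \<in> F2pow_poly n \<and> B \<in> F2pow_poly n}"

lemma R_ev: "A \<in> F2pow_poly n \<Longrightarrow> B \<in> F2pow_poly n \<Longrightarrow> ev A B \<in> R"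
  unfolding R_def by blast

lemma RE: "a \<in> R \<Longrightarrow> (\<And>A B. A \<in> F2pow_poly n \<Longrightarrow> B \<in> F2pow_poly n \<Longrightarrow> a = ev A B \<Longrightarrow> thesis) \<Longrightarrow> thesis"
  unfolding R_def by blast

definition K :: "ambient set" where
  "K = {a / b | a b. a \<in> R \<and> b \<in> R \<and> b \<noteq> 0}"

lemma s_ev: "s = ev [:0, 1:] 0" and w_ev: "w = ev 0 1" and const_ev: "c = ev [:c:] 0"
  by (simp_all add: ev_def)

lemma s_R: "s \<in> R" and w_R: "w \<in> R" and const_R: "c \<in> F2pow n \<Longrightarrow> c \<in> R"
proof -
  show "s \<in> R" by (subst s_ev, rule R_ev) (auto simp: F2pow_poly_pCons F2pow_poly_0)
  show "w \<in> R" by (subst w_ev, rule R_ev) (auto simp: F2pow_poly_pCons F2pow_poly_0 one_pCons)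
  show "c \<in> F2pow n \<Longrightarrow> c \<in> R"
    by (subst const_ev, rule R_ev) (auto simp: F2pow_poly_const F2pow_poly_0)
qed

lemma R_add: "a \<in> R \<Longrightarrow> b \<in> R \<Longrightarrow> a + b \<in> R"
  by (elim RE) (simp add: ev_add R_ev F2pow_poly_add)

lemma R_mult: "a \<in> R \<Longrightarrow> b \<in> R \<Longrightarrow> a * b \<in> R"
  by (elim RE) (auto simp: ev_mult intro!: R_ev F2pow_poly_add F2pow_poly_mult \<alpha>_F \<beta>_F)

end

locale curve_point = curve +
  fixes c d :: ambient
  assumes cd: "c \<in> F2pow n" "d \<in> F2pow n" "d ^ 2 + c ^ m * d = c + c ^ (r + 1)"
begin

text \<open>The evaluation of the functions in \<open>R\<close> at \<open>(c, d)\<close>; the choice is unique by \<open>ev_eq_0\<close>.\<close>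

definition e :: "ambient \<Rightarrow> ambient" where
  "e u = (let (A, B) = (SOME (A, B). A \<in> F2pow_poly n \<and> B \<in> F2pow_poly n \<and> u = ev A B)
     in poly A c + poly B c * d)"

lemma e_ev:
  assumes "A \<in> F2pow_poly n" "B \<in> F2pow_poly n"
  shows "e (ev A B) = poly A c + poly B c * d"
proof -
  define p where "p = (SOME (A', B'). A' \<in> F2pow_poly n \<and> B' \<in> F2pow_poly n \<and> ev A B = ev A' B')"
  have "case p of (A', B') \<Rightarrow> A' \<in> F2pow_poly n \<and> B' \<in> F2pow_poly n \<and> ev A B = ev A' B'"
    unfolding p_def by (rule someI[of _ "(A, B)"]) (use assms in simp)
  moreover obtain A' B' where p: "p = (A', B')" by force
  ultimately have *: "A' \<in> F2pow_poly n" "B' \<in> F2pow_poly n" "ev A B = ev A' B'" by auto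
  have "ev (A + A') (B + B') = 0" using * by (simp flip: ev_add)
  hence "A + A' = 0" "B + B' = 0"
    using ev_eq_0[of "A + A'" "B + B'"] assms * by (auto intro: F2pow_poly_add)
  hence "poly (A + A') c = 0" "poly (B + B') c = 0" by simp_all
  hence "poly A c = poly A' c" "poly B c = poly B' c" by (simp_all add: ambient_add_eq_0_iff)
  thus ?thesis by (simp add: e_def p flip: p_def)
qed

lemma e_F: "a \<in> R \<Longrightarrow> e a \<in> F2pow n"
  by (elim RE) (auto simp: e_ev intro!: F2pow_add F2pow_mult F2pow_poly_eval cd)

lemma e_const: "a \<in> F2pow n \<Longrightarrow> e a = a"
  using e_ev[of "[:a:]" 0] by (simp add: F2pow_poly_const F2pow_poly_0 flip: const_ev)

lemma e_s: "e s = c" and e_w: "e w = d"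
  using e_ev[of "[:0, 1:]" 0] e_ev[of 0 1]
  by (simp_all add: F2pow_poly_pCons F2pow_poly_0 one_pCons flip: s_ev w_ev[unfolded one_pCons])

lemma e_add: "a \<in> R \<Longrightarrow> b \<in> R \<Longrightarrow> e (a + b) = e a + e b"
  by (elim RE) (simp add: ev_add e_ev F2pow_poly_add algebra_simps)

lemma e_mult: "a \<in> R \<Longrightarrow> b \<in> R \<Longrightarrow> e (a * b) = e a * e b"
proof (elim RE)
  fix A B A' B' assume *: "A \<in> F2pow_poly n" "B \<in> F2pow_poly n" "a = ev A B"
    "A' \<in> F2pow_poly n" "B' \<in> F2pow_poly n" "b = ev A' B'"
  have d_sq: "d ^ 2 = poly \<beta> c + poly \<alpha> c * d"
    using cd(3) ambient_add_cancel[of "poly \<alpha> c * d" "d ^ 2"]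
    by (simp add: poly_\<alpha> poly_\<beta> add_ac)
  have "e a * e b = poly (A * A') c + (poly (A * B') c + poly (B * A') c) * d + poly (B * B') c * d ^ 2"
    using * by (simp add: e_ev algebra_simps power2_eq_square)
  also have "\<dots> = poly (A * A' + B * B' * \<beta>) c + poly (A * B' + B * A' + B * B' * \<alpha>) c * d"
    by (simp add: d_sq algebra_simps)
  also have "\<dots> = e (a * b)"
    unfolding *(3,6) ev_mult
    by (rule e_ev[symmetric]) (auto intro!: F2pow_poly_add F2pow_poly_mult * \<alpha>_F \<beta>_F)
  finally show ?thesis by simp
qed

text \<open>A common zero of \<open>A\<close> and \<open>B\<close> at \<open>c\<close> is divided
  out as a factor \<open>s + c\<close>. If \<open>B\<close> does not vanish at \<open>c\<close>,
  multiplication by the conjugate \<open>P\<close> of \<open>ev A B\<close> leaves the norm, a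
  polynomial in \<open>s\<close> alone; \<open>P\<close> is nonzero at the point because the two
  points over \<open>c\<close> have second coordinates differing by \<open>c^m\<close>.\<close>

lemma uniformizer_unramified:
  assumes c: "c \<noteq> 0" and AB: "A \<in> F2pow_poly n" "B \<in> F2pow_poly n" "ev A B \<noteq> 0"
  shows "\<exists>i b f. b \<in> R \<and> f \<in> R \<and> e b \<noteq> 0 \<and> e f \<noteq> 0 \<and> ev A B * b = (s + c) ^ i * f"
  using AB
proof (induction "Polynomial.degree A + Polynomial.degree B" arbitrary: A B rule: less_induct)
  case less
  note AB = less.prems
  consider "e (ev A B) \<noteq> 0" | "e (ev A B) = 0" "poly B c = 0" | "e (ev A B) = 0" "poly B c \<noteq> 0"
    by blast
  thus ?case
  proof cases
    case 1
    thus ?thesis using AB R_ev const_R[of 1] e_const[of 1]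
      by (intro exI[of _ 0] exI[of _ 1] exI[of _ "ev A B"]) simp
  next
    case 2
    hence "poly A c = 0" using AB by (simp add: e_ev)
    obtain A' where A': "A' \<in> F2pow_poly n" "A = [:c, 1:] * A'"
        "A \<noteq> 0 \<Longrightarrow> Polynomial.degree A' < Polynomial.degree A"
      using F2pow_poly_root[OF AB(1) cd(1) \<open>poly A c = 0\<close>] by metis
    obtain B' where B': "B' \<in> F2pow_poly n" "B = [:c, 1:] * B'"
        "B \<noteq> 0 \<Longrightarrow> Polynomial.degree B' < Polynomial.degree B"
      using F2pow_poly_root[OF AB(2) cd(1) 2(2)] by metis
    have eq: "ev A B = (s + c) * ev A' B'"
      by (simp add: A'(2) B'(2) ev_def algebra_simps)
    have "A \<noteq> 0 \<or> B \<noteq> 0" using AB(3) by (auto simp: ev_def)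
    moreover have "[:c, 1:] \<noteq> 0" by simp
    hence "A = 0 \<Longrightarrow> A' = 0" "B = 0 \<Longrightarrow> B' = 0"
      using A'(2) B'(2) by (metis mult_eq_0_iff)+
    ultimately have "Polynomial.degree A' + Polynomial.degree B' < Polynomial.degree A + Polynomial.degree B"
      using A'(3) B'(3) by (cases "A = 0"; cases "B = 0") auto
    moreover have "ev A' B' \<noteq> 0" using eq AB(3) by auto
    ultimately obtain i b f where "b \<in> R" "f \<in> R" "e b \<noteq> 0" "e f \<noteq> 0" "ev A' B' * b = (s + c) ^ i * f"
      using less.hyps A'(1) B'(1) by metis
    thus ?thesis
      by (intro exI[of _ "Suc i"] exI[of _ b] exI[of _ f]) (simp add: eq mult.assoc)
  next
    case 3
    define N where "N = A * (A + \<alpha> * B) + B * B * \<beta>"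
    define P where "P = ev (A + \<alpha> * B) B"
    have A2: "A + \<alpha> * B \<in> F2pow_poly n" using AB by (intro F2pow_poly_add F2pow_poly_mult \<alpha>_F)
    have P: "P \<in> R" unfolding P_def by (rule R_ev[OF A2 AB(2)])
    have "e P = e (ev A B) + c ^ m * poly B c"
      using AB A2 by (simp add: P_def e_ev poly_\<alpha> add_ac)
    hence eP: "e P \<noteq> 0" using 3 c by simp
    have N: "N \<in> F2pow_poly n"
      unfolding N_def using AB A2 by (intro F2pow_poly_add F2pow_poly_mult \<alpha>_F \<beta>_F)
    have "A * B + B * (A + \<alpha> * B) + B * B * \<alpha> = 0"
    proof (rule poly_eqI)
      fix i
      have "A * B + B * (A + \<alpha> * B) + B * B * \<alpha> = (A * B + A * B) + (\<alpha> * B * B + \<alpha> * B * B)"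
        by (simp only: distrib_left mult_ac add_ac)
      thus "poly.coeff (A * B + B * (A + \<alpha> * B) + B * B * \<alpha>) i = poly.coeff 0 i"
        by (simp only: coeff_add ambient_add_self coeff_0 add_0)
    qed
    hence prod: "ev A B * P = poly N s"
      unfolding P_def ev_mult by (simp add: ev_def N_def)
    have "e 0 = 0" using e_const[of 0] by simp
    hence "P \<noteq> 0" using eP by auto
    hence "N \<noteq> 0" using prod AB(3) by auto
    then obtain j N' where N': "N' \<in> F2pow_poly n" "N = [:c, 1:] ^ j * N'" "poly N' c \<noteq> 0"
      using F2pow_poly_root_power[OF N cd(1)] by blast
    have "poly N' s = ev N' 0" by (simp add: ev_def)
    moreover have "e (ev N' 0) \<noteq> 0" using N' by (simp add: e_ev F2pow_poly_0)
    ultimately have "poly N' s \<in> R" "e (poly N' s) \<noteq> 0" using N'(1) F2pow_poly_0 by (auto intro: R_ev)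
    moreover have "ev A B * P = (s + c) ^ j * poly N' s"
      unfolding prod N'(2) by (simp add: poly_power add.commute)
    ultimately show ?thesis using P eP by blast
  qed
qed

text \<open>The curve equation reads \<open>s * \<delta> = w ^ 2\<close> with
  \<open>\<delta> = 1 + s^r + s^(m-1) w\<close> a unit at the origin, so each common factor
  \<open>s\<close> of \<open>A\<close> and \<open>B\<close> contributes two factors
  \<open>w\<close>. If only \<open>A\<close> vanishes at 0, exactly one factor \<open>w\<close>
  splits off.\<close>

lemma uniformizer_ramified:
  assumes c: "c = 0" "d = 0" and AB: "A \<in> F2pow_poly n" "B \<in> F2pow_poly n" "ev A B \<noteq> 0"
  shows "\<exists>i b f. b \<in> R \<and> f \<in> R \<and> e b \<noteq> 0 \<and> e f \<noteq> 0 \<and> ev A B * b = w ^ i * f"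
  using AB
proof (induction "Polynomial.degree A + Polynomial.degree B" arbitrary: A B rule: less_induct)
  case less
  note AB = less.prems
  define \<delta> where "\<delta> = ev (1 + Polynomial.monom 1 r) (Polynomial.monom 1 (m - 1))"
  have one_F: "1 \<in> F2pow_poly n" by (simp add: one_pCons F2pow_poly_const)
  have \<delta>R: "\<delta> \<in> R"
    unfolding \<delta>_def by (intro R_ev F2pow_poly_add F2pow_poly_monom one_F) auto
  have "e \<delta> = poly (1 + Polynomial.monom 1 r) c + poly (Polynomial.monom 1 (m - 1)) c * d"
    unfolding \<delta>_def by (rule e_ev) (intro F2pow_poly_add F2pow_poly_monom one_F; simp)+
  hence e\<delta>: "e \<delta> = 1" using r by (simp add: c poly_monom)
  have s\<delta>: "s * \<delta> = w ^ 2"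
  proof -
    have sm: "s * s ^ (m - 1) = s ^ m" using m by (simp flip: power_Suc)
    have "s * \<delta> = s + s ^ (r + 1) + s * s ^ (m - 1) * w"
      by (simp add: \<delta>_def ev_def poly_monom algebra_simps)
    thus ?thesis by (simp only: sm w_sq poly_\<alpha> poly_\<beta>)
  qed
  show ?case
  proof (cases "poly A 0 = 0")
    case False
    have "poly A c + poly B c * d \<noteq> 0" using False c by simp
    hence "e (ev A B) \<noteq> 0" using e_ev[OF AB(1,2)] by simp
    thus ?thesis using AB R_ev const_R[of 1] e_const[of 1]
      by (intro exI[of _ 0] exI[of _ 1] exI[of _ "ev A B"]) simp
  next
    case True
    obtain A' where A': "A' \<in> F2pow_poly n" "A = [:0, 1:] * A'"
        "A \<noteq> 0 \<Longrightarrow> Polynomial.degree A' < Polynomial.degree A"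
      using F2pow_poly_root[OF AB(1) F2pow_0 True] by metis
    have As: "poly A s = s * poly A' s" by (simp add: A'(2))
    show ?thesis
    proof (cases "poly B 0 = 0")
      case False
      define f where "f = ev 0 A' + ev B 0 * \<delta>"
      have "ev A B * \<delta> = w ^ 1 * f"
      proof -
        have "ev A B * \<delta> = (s * \<delta>) * poly A' s + poly B s * w * \<delta>"
          by (simp add: ev_def As algebra_simps)
        also have "\<dots> = w ^ 1 * f"
          unfolding s\<delta> f_def by (simp add: ev_def algebra_simps power2_eq_square)
        finally show ?thesis .
      qed
      moreover have fR: "f \<in> R" unfolding f_def
        by (intro R_add R_mult R_ev \<delta>R AB A' F2pow_poly_0)
      moreover have "e f = poly B 0"
      proof -
        have "e f = e (ev 0 A') + e (ev B 0) * e \<delta>"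
          unfolding f_def using AB A' \<delta>R by (simp add: e_add e_mult R_mult R_ev F2pow_poly_0)
        moreover have "e (ev 0 A') = 0" using e_ev[OF F2pow_poly_0 A'(1)] c(2) by simp
        moreover have "e (ev B 0) = poly B 0" using e_ev[OF AB(2) F2pow_poly_0] c by simp
        ultimately show ?thesis using e\<delta> by simp
      qed
      ultimately show ?thesis using False \<delta>R e\<delta>
        by (intro exI[of _ 1] exI[of _ \<delta>] exI[of _ f]) simp
    next
      case B0: True
      obtain B' where B': "B' \<in> F2pow_poly n" "B = [:0, 1:] * B'"
          "B \<noteq> 0 \<Longrightarrow> Polynomial.degree B' < Polynomial.degree B"
        using F2pow_poly_root[OF AB(2) F2pow_0 B0] by metis
      have eq: "ev A B = s * ev A' B'"
        by (simp add: A'(2) B'(2) ev_def algebra_simps)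
      have "A \<noteq> 0 \<or> B \<noteq> 0" using AB(3) by (auto simp: ev_def)
      moreover have "A = 0 \<Longrightarrow> A' = 0" "B = 0 \<Longrightarrow> B' = 0" using A'(2) B'(2) by auto
      ultimately have "Polynomial.degree A' + Polynomial.degree B' < Polynomial.degree A + Polynomial.degree B"
        using A'(3) B'(3) by (cases "A = 0"; cases "B = 0") auto
      moreover have "ev A' B' \<noteq> 0" using eq AB(3) by auto
      ultimately obtain i b f where ibf: "b \<in> R" "f \<in> R" "e b \<noteq> 0" "e f \<noteq> 0" "ev A' B' * b = w ^ i * f"
        using less.hyps A'(1) B'(1) by metis
      have "ev A B * (b * \<delta>) = (s * \<delta>) * (ev A' B' * b)" by (simp only: eq mult_ac)
      also have "\<dots> = w ^ (2 + i) * f" by (simp only: s\<delta> ibf(5) power_add mult.assoc)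
      finally show ?thesis using ibf \<delta>R e\<delta>
        by (intro exI[of _ "2 + i"] exI[of _ "b * \<delta>"] exI[of _ f]) (simp add: e_mult R_mult)
    qed
  qed
qed

definition t :: ambient where
  "t = (if c = 0 then w else s + c)"

sublocale local_ring n K R e t
proof unfold_locales
  show "K = {a / b |a b. a \<in> R \<and> b \<in> R \<and> b \<noteq> 0}" by (rule K_def)
  have d0: "d = 0" if "c = 0" using cd(3) that m r by (simp add: power_0_left)
  show "t \<in> R" using s_R w_R const_R cd R_add by (simp add: t_def)
  show "t \<noteq> 0"
  proof -
    have "ev 0 1 \<noteq> 0" using ev_eq_0(2)[of 0 1] by (auto simp: F2pow_poly_0 one_pCons F2pow_poly_const)
    moreover have "ev [:c, 1:] 0 \<noteq> 0"
      using ev_eq_0(1)[of "[:c, 1:]" 0] cd by (auto simp: F2pow_poly_0 F2pow_poly_pCons)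
    ultimately show ?thesis by (auto simp: t_def ev_def add.commute)
  qed
  show "e t = 0"
  proof (cases "c = 0")
    case True
    hence "t = w" unfolding t_def by (rule if_P)
    thus ?thesis using e_w d0[OF True] by metis
  next
    case False
    have "e (s + c) = 0" using e_add[OF s_R const_R[OF cd(1)]] e_s e_const[OF cd(1)] by simp
    thus ?thesis using False by (simp add: t_def)
  qed
  show "\<exists>i b f. b \<in> R \<and> f \<in> R \<and> e b \<noteq> 0 \<and> e f \<noteq> 0 \<and> a * b = t ^ i * f" if a: "a \<in> R" "a \<noteq> 0" for a
  proof -
    obtain A B where AB: "A \<in> F2pow_poly n" "B \<in> F2pow_poly n" "a = ev A B" using a by (auto elim: RE)
    show ?thesis
    proof (cases "c = 0")
      case True
      hence tw: "t = w" unfolding t_def by (rule if_P)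
      show ?thesis
        using uniformizer_ramified[OF True d0[OF True] AB(1,2)] a(2) unfolding tw AB(3) by blast
    next
      case False
      hence ts: "t = s + c" unfolding t_def by (rule if_not_P)
      show ?thesis
        using uniformizer_unramified[OF False AB(1,2)] a(2) unfolding ts AB(3) by blast
    qed
  qed
qed (use const_R R_add R_mult e_F e_const e_add e_mult in auto)

end

section \<open>The rational places of the curve\<close>

context curve
begin

text \<open>Used for both charts with \<open>H\<close> consisting of \<open>x\<close> and
  \<open>y\<close>, to identify their fields of fractions with one and the same function
  field.\<close>

lemma K_eq_generate_field:
  assumes "s \<in> generate_field ambient_ring (F2pow n \<union> H)" "w \<in> generate_field ambient_ring (F2pow n \<union> H)"
    and "H \<subseteq> K"
  shows "K = generate_field ambient_ring (F2pow n \<union> H)"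
proof
  let ?E = "generate_field ambient_ring (F2pow n \<union> H)"
  note E = generate_field_closed[where H = "F2pow n \<union> H"]
  have poly_E: "poly A s \<in> ?E" if "A \<in> F2pow_poly n" for A
    using that
    by (induction A) (use E assms in \<open>auto simp: F2pow_poly_pCons\<close>)
  have "R \<subseteq> ?E"
    using poly_E E(4,5) assms(2) by (auto simp: R_def ev_def)
  thus "K \<subseteq> ?E"
    unfolding K_def divide_inverse using E(5,6) by blast
  have RK: "a \<in> K" if "a \<in> R" for a
    using that const_R[of 1] unfolding K_def by force
  show "?E \<subseteq> K"
  proof (rule generate_field_ambient)
    show "1 \<in> K" using RK const_R[of 1] by simp
    show "F2pow n \<union> H \<subseteq> K" using RK const_R assms(3) by blast
    show "a + b \<in> K" if ab: "a \<in> K" "b \<in> K" for a b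
    proof -
      obtain a1 a2 b1 b2 where *: "a1 \<in> R" "a2 \<in> R" "a2 \<noteq> 0" "a = a1 / a2" "b1 \<in> R" "b2 \<in> R" "b2 \<noteq> 0" "b = b1 / b2"
        using ab unfolding K_def by blast
      hence "a + b = (a1 * b2 + b1 * a2) / (a2 * b2)" by (simp add: add_frac_eq)
      moreover have "a1 * b2 + b1 * a2 \<in> R" "a2 * b2 \<in> R" "a2 * b2 \<noteq> 0" using * R_add R_mult by auto
      ultimately show ?thesis unfolding K_def by blast
    qed
    show "a * b \<in> K" if ab: "a \<in> K" "b \<in> K" for a b
    proof -
      obtain a1 a2 b1 b2 where *: "a1 \<in> R" "a2 \<in> R" "a2 \<noteq> 0" "a = a1 / a2" "b1 \<in> R" "b2 \<in> R" "b2 \<noteq> 0" "b = b1 / b2"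
        using ab unfolding K_def by blast
      hence "a * b = (a1 * b1) / (a2 * b2)" by simp
      moreover have "a1 * b1 \<in> R" "a2 * b2 \<in> R" "a2 * b2 \<noteq> 0" using * R_mult by auto
      ultimately show ?thesis unfolding K_def by blast
    qed
    show "inverse a \<in> K" if a: "a \<in> K" for a
    proof -
      obtain a1 a2 where *: "a1 \<in> R" "a2 \<in> R" "a2 \<noteq> 0" "a = a1 / a2" using a unfolding K_def by blast
      show ?thesis
      proof (cases "a1 = 0")
        case False
        hence "inverse a = a2 / a1" using * by simp
        thus ?thesis using * False unfolding K_def by blast
      qed (use * a in simp)
    qed
  qed
qed

definition affine_points :: "(ambient \<times> ambient) set" where
  "affine_points = {(c, d). c \<in> F2pow n \<and> d \<in> F2pow n \<and> d ^ 2 + c ^ m * d = c + c ^ (r + 1)}"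

lemma K_closed: "a \<in> K \<Longrightarrow> b \<in> K \<Longrightarrow> a * b \<in> K" "a \<in> K \<Longrightarrow> inverse a \<in> K"
proof -
  \<comment> \<open>The origin lies on every curve of this shape and gives access to the general
    facts about local rings.\<close>
  interpret curve_point n m r s w 0 0
    by unfold_locales (use m r in simp_all)
  show "a \<in> K \<Longrightarrow> b \<in> K \<Longrightarrow> a * b \<in> K" "a \<in> K \<Longrightarrow> inverse a \<in> K"
    by (rule K_mult, assumption+) (rule K_inverse)
qed

definition centered :: "ambient set \<Rightarrow> ambient \<Rightarrow> ambient \<Rightarrow> bool" where
  "centered V c d \<longleftrightarrow> c \<in> F2pow n \<and> d \<in> F2pow n \<and>
     s + c \<in> maximal_ideal_of V \<and> w + d \<in> maximal_ideal_of V"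

text \<open>Existence is the local ring of the point. For uniqueness, the residues of
  \<open>s\<close> and \<open>w\<close> determine those of all of \<open>R\<close>, so
  \<open>V\<close> dominates that local ring, which is maximal for domination.\<close>

lemma ex1_centered:
  assumes "(c, d) \<in> affine_points"
  shows "\<exists>!V. V \<in> rational_places (F2pow n) K \<and> centered V c d"
proof -
  interpret curve_point n m r s w c d
    by unfold_locales (use assms in \<open>auto simp: affine_points_def\<close>)
  have "centered W c d"
    using residue_W[OF s_R] residue_W[OF w_R] cd by (simp add: centered_def e_s e_w)
  moreover have "V = W" if place: "V \<in> rational_places (F2pow n) K" "centered V c d" for V
  proof (rule W_unique)
    show VR: "valuation_ring (F2pow n) K V" using place by (simp add: rational_places_def)
    interpret valuation n K V by standard (use VR K_closed in auto)
    have s: "res s c" and w: "res w d" using place(2) by (auto simp: centered_def res_def)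
    fix a assume "a \<in> R"
    then obtain A B where AB: "A \<in> F2pow_poly n" "B \<in> F2pow_poly n" "a = ev A B" by (auto elim: RE)
    have "res (ev A B) (poly A c + poly B c * d)"
      unfolding ev_def using AB by (intro res_add res_mult res_poly s w) (auto simp: F2pow_poly_def)
    thus "a + e a \<in> maximal_ideal_of V" using e_ev[OF AB(1,2)] AB(3) by (simp add: res_def)
  qed
  ultimately show ?thesis using rational_place_W by blast
qed

text \<open>The equation makes \<open>w\<close> integral over the polynomials in \<open>s\<close>,
  so \<open>V\<close> contains \<open>w\<close> along with \<open>s\<close>, and the residues of
  \<open>s\<close> and \<open>w\<close> satisfy the same equation.\<close>

lemma place_centered:
  assumes place: "V \<in> rational_places (F2pow n) K" and s: "s \<in> V"
  shows "\<exists>p\<in>affine_points. centered V (fst p) (snd p)"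
proof -
  have VR: "valuation_ring (F2pow n) K V" using place by (simp add: rational_places_def)
  interpret valuation n K V by standard (use VR K_closed in auto)
  have ex: "\<exists>c. res u c" if "u \<in> V" for u
    using place that by (auto simp: rational_places_def res_def)
  have wK: "w \<in> K" using w_R const_R[of 1] unfolding K_def by force
  have w: "w \<in> V"
  proof (rule ccontr)
    assume nw: "w \<notin> V"
    hence iw: "inverse w \<in> V" using V_total[OF wK] by blast
    have w0: "w \<noteq> 0" using nw V_0 by auto
    hence iM: "inverse w \<in> M" using iw nw by (simp add: maximal_ideal_of_def)
    have "w = inverse w * w ^ 2" using w0 by (simp add: power2_eq_square)
    also have "\<dots> = inverse w * (s + s ^ (r + 1)) + s ^ m"
      unfolding w_sq poly_\<alpha> poly_\<beta> using w0 by (simp add: distrib_left)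
    also have "\<dots> \<in> V" by (intro V_add V_mult V_power s iw)
    finally show False using nw by simp
  qed
  obtain c d where cd: "res s c" "res w d" using ex s w by blast
  have "res (w ^ 2 + s ^ m * w) (d ^ 2 + c ^ m * d)" by (intro res_add res_mult res_power cd)
  moreover have "res (s + s ^ (r + 1)) (c + c ^ (r + 1))" by (intro res_add res_power cd)
  ultimately have "d ^ 2 + c ^ m * d = c + c ^ (r + 1)" using res_unique curve_eq by metis
  hence "(c, d) \<in> affine_points" using cd by (simp add: affine_points_def res_def)
  thus ?thesis using cd by (intro bexI[of _ "(c, d)"]) (auto simp: centered_def res_def)
qed

lemma centered_unique:
  assumes place: "V \<in> rational_places (F2pow n) K" and "centered V c d" "centered V c' d'"
  shows "c = c'" "d = d'" "s \<in> V"
proof -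
  have VR: "valuation_ring (F2pow n) K V" using place by (simp add: rational_places_def)
  interpret valuation n K V by standard (use VR K_closed in auto)
  have "res s c" "res w d" "res s c'" "res w d'" using assms by (auto simp: centered_def res_def)
  thus "c = c'" "d = d'" "s \<in> V" using res_unique res_V by blast+
qed

lemma card_places_affine:
  "bij_betw (\<lambda>p. THE V. V \<in> rational_places (F2pow n) K \<and> centered V (fst p) (snd p))
     affine_points {V \<in> rational_places (F2pow n) K. s \<in> V}"
proof (rule bij_betwI')
  let ?V = "\<lambda>p. THE V. V \<in> rational_places (F2pow n) K \<and> centered V (fst p) (snd p)"
  have V: "?V p \<in> rational_places (F2pow n) K" "centered (?V p) (fst p) (snd p)" if "p \<in> affine_points" for p
    using theI'[OF ex1_centered[of "fst p" "snd p"]] that by auto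
  show "?V p = ?V q \<longleftrightarrow> p = q" if p: "p \<in> affine_points" and q: "q \<in> affine_points" for p q
  proof
    assume eq: "?V p = ?V q"
    have "centered (?V p) (fst q) (snd q)" unfolding eq by (rule V(2)[OF q])
    from centered_unique(1,2)[OF V[OF p] this] show "p = q" by (rule prod_eqI)
  qed simp
  show "?V p \<in> {V \<in> rational_places (F2pow n) K. s \<in> V}" if "p \<in> affine_points" for p
    using V[OF that] centered_unique(3) by blast
  show "\<exists>p\<in>affine_points. U = ?V p" if "U \<in> {V \<in> rational_places (F2pow n) K. s \<in> V}" for U
  proof -
    have U: "U \<in> rational_places (F2pow n) K" "s \<in> U" using that by auto
    obtain p where p: "p \<in> affine_points" "centered U (fst p) (snd p)"
      using place_centered[OF U] by blast
    have "(fst p, snd p) \<in> affine_points" using p(1) by simp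
    from the1_equality[OF ex1_centered[OF this], of U] have "?V p = U" using U(1) p(2) by blast
    thus ?thesis using p(1) by blast
  qed
qed

text \<open>Setting \<open>s = 0\<close> in the equation leaves \<open>w^2 = 0\<close>, so the
  origin is the only point over \<open>s = 0\<close>. On the chart with \<open>s = 1/x\<close> this
  is the place at infinity.\<close>

lemma ex1_place_over_0:
  "\<exists>!V. V \<in> rational_places (F2pow n) K \<and> s \<in> maximal_ideal_of V"
proof -
  have p0: "(0, 0) \<in> affine_points" using m r by (simp add: affine_points_def)
  have "centered V 0 0" if place: "V \<in> rational_places (F2pow n) K" "s \<in> maximal_ideal_of V" for V
  proof -
    have VR: "valuation_ring (F2pow n) K V" using place by (simp add: rational_places_def)
    interpret valuation n K V by standard (use VR K_closed in auto)
    obtain c d where cd: "(c, d) \<in> affine_points" "centered V c d"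
      using place_centered[OF place(1) M_V[OF place(2)]] by auto
    have "res s c" "res s 0" using cd(2) place(2) by (auto simp: centered_def res_def)
    hence "c = 0" by (rule res_unique)
    moreover from this have "d = 0" using cd(1) m by (simp add: affine_points_def power_0_left)
    ultimately show ?thesis using cd(2) by simp
  qed
  moreover have "s \<in> maximal_ideal_of V" if "centered V 0 0" for V
    using that by (simp add: centered_def)
  ultimately have iff: "V \<in> rational_places (F2pow n) K \<and> s \<in> maximal_ideal_of V \<longleftrightarrow>
      V \<in> rational_places (F2pow n) K \<and> centered V 0 0" for V by blast
  show ?thesis unfolding iff by (rule ex1_centered[OF p0])
qed

end

section \<open>Counting the points of \<open>D\<^sub>k\<close>\<close>

lemma trace2_add: "trace2 n (a + b) = trace2 n a + trace2 n b"
  by (simp add: trace2_def frobenius_add sum.distrib)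

text \<open>The additive Hilbert theorem 90, by counting: the image of \<open>b \<mapsto> b\<^sup>2 + b\<close> has \<open>2\<^sup>n\<^sup>-\<^sup>1\<close>
  elements and consists of roots of the trace polynomial.\<close>

lemma card_artin_schreier:
  assumes n: "n \<ge> 1" and u: "u \<in> F2pow n"
  shows "card {b \<in> F2pow n. b ^ 2 + b = u} = (if trace2 n u = 0 then 2 else 0)"
proof -
  define \<phi> where "\<phi> = (\<lambda>b::ambient. b ^ 2 + b)"
  have fin: "finite (F2pow n)" using n by (intro finite_F2pow) auto
  have fiber: "{b \<in> F2pow n. \<phi> b = \<phi> a} = {a, a + 1}" if a: "a \<in> F2pow n" for a
  proof (intro equalityI subsetI)
    fix b assume b: "b \<in> {b \<in> F2pow n. \<phi> b = \<phi> a}"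
    \<comment> \<open>Two elements with the same image differ by 0 or 1.\<close>
    have "(a + b) * (a + b + 1) = \<phi> a + \<phi> b + (a * b + a * b)"
      by (simp only: \<phi>_def power2_eq_square distrib_left distrib_right add_ac mult_ac mult_1_right mult_1_left)
    also have "\<dots> = 0" using b by simp
    finally have "a + b = 0 \<or> (a + 1) + b = 0" by (simp add: add_ac)
    thus "b \<in> {a, a + 1}" by (auto simp: ambient_add_eq_0_iff)
  next
    fix b assume b: "b \<in> {a, a + 1}"
    have "\<phi> (a + 1) = \<phi> a"
    proof -
      have "\<phi> (a + 1) = \<phi> a + ((a + a) + (1 + 1))"
        by (simp only: \<phi>_def power2_eq_square distrib_left distrib_right add_ac mult_1_left mult_1_right)
      thus ?thesis by (simp only: ambient_add_self add_0_right)
    qed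
    thus "b \<in> {b \<in> F2pow n. \<phi> b = \<phi> a}" using a b by (auto intro: F2pow_add)
  qed
  have card_fiber: "card {b \<in> F2pow n. \<phi> b = v} = 2" if "v \<in> \<phi> ` F2pow n" for v
  proof -
    from that obtain a where a: "a \<in> F2pow n" "v = \<phi> a" by blast
    have "a + 1 \<noteq> a" by simp
    hence "card {a, a + 1} = 2" by simp
    thus ?thesis using fiber[OF a(1)] a(2) by simp
  qed
  have "card (F2pow n) = (\<Sum>v\<in>\<phi> ` F2pow n. card {b \<in> F2pow n. \<phi> b = v})"
  proof -
    have "card (\<Union>v\<in>\<phi> ` F2pow n. {b \<in> F2pow n. \<phi> b = v}) = (\<Sum>v\<in>\<phi> ` F2pow n. card {b \<in> F2pow n. \<phi> b = v})"
      using fin by (intro card_UN_disjoint) auto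
    moreover have "(\<Union>v\<in>\<phi> ` F2pow n. {b \<in> F2pow n. \<phi> b = v}) = F2pow n" by auto
    ultimately show ?thesis by simp
  qed
  also have "\<dots> = 2 * card (\<phi> ` F2pow n)" by (simp add: card_fiber)
  finally have "2 * card (\<phi> ` F2pow n) = 2 ^ n" using n by (simp add: card_F2pow)
  moreover obtain n' where n': "n = Suc n'" using n by (cases n) auto
  ultimately have card_im: "card (\<phi> ` F2pow n) = 2 ^ n'" by simp
  define T :: "ambient poly" where "T = (\<Sum>i<n. Polynomial.monom 1 (2 ^ i))"
  have T: "poly T v = trace2 n v" for v
    by (simp add: T_def trace2_def poly_sum poly_monom)
  have coeff_T: "poly.coeff T j = (\<Sum>i<n. if 2 ^ i = j then 1 else 0)" for j
    by (simp add: T_def coeff_sum)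
  have "poly.coeff T (2 ^ n') = (\<Sum>i<n. if i = n' then 1 else 0)"
    unfolding coeff_T by (intro sum.cong refl) auto
  hence T0: "T \<noteq> 0" using n' by auto
  have deg_T: "Polynomial.degree T \<le> 2 ^ n'"
    unfolding T_def
    by (intro degree_sum_le) (auto simp: n' degree_monom_eq intro!: power_increasing)
  have im: "\<phi> ` F2pow n \<subseteq> {v. poly T v = 0}"
  proof
    fix v assume "v \<in> \<phi> ` F2pow n"
    then obtain b where b: "b \<in> F2pow n" "v = \<phi> b" by blast
    have sq: "(b ^ 2) ^ (2 ^ i) = b ^ (2 ^ Suc i)" for i by (simp flip: power_mult)
    have "trace2 n (b ^ 2) + trace2 n b = 0"
    proof -
      \<comment> \<open>Both traces are completed to the sum with \<open>Suc n\<close> terms, whose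
        last term is \<open>b ^ (2 ^ n) = b\<close>.\<close>
      have "trace2 n (b ^ 2) + b = (\<Sum>i<Suc n. b ^ (2 ^ i))"
        unfolding trace2_def sq by (subst sum.lessThan_Suc_shift) (simp add: add.commute)
      also have "\<dots> = trace2 n b + b" using b(1) by (simp add: trace2_def F2pow_def)
      finally show ?thesis by (simp add: ambient_add_eq_0_iff)
    qed
    thus "v \<in> {v. poly T v = 0}" by (simp add: T b(2) \<phi>_def trace2_add)
  qed
  have finT: "finite {v. poly T v = 0}" by (rule poly_roots_finite[OF T0])
  \<comment> \<open>The degree bound for \<open>T\<close> is also the size of the image, so the
    image is the whole root set.\<close>
  have "card {v. poly T v = 0} \<le> 2 ^ n'"
    using card_poly_roots_bound[OF T0] deg_T by linarith
  hence im_eq: "\<phi> ` F2pow n = {v. poly T v = 0}"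
    using card_im by (intro card_subset_eq[OF finT im]) (use card_mono[OF finT im] in linarith)
  show ?thesis
  proof (cases "trace2 n u = 0")
    case True
    hence "u \<in> \<phi> ` F2pow n" by (simp add: im_eq T)
    thus ?thesis using card_fiber[of u] True by (simp add: \<phi>_def)
  next
    case False
    hence "u \<notin> \<phi> ` F2pow n" by (simp add: im_eq T)
    hence empty: "{b \<in> F2pow n. b ^ 2 + b = u} = {}" by (auto simp: \<phi>_def)
    show ?thesis unfolding empty using False by simp
  qed
qed

text \<open>The powers of an element algebraic over a finite field lie in a finite set, the values
  of the polynomials of degree below \<open>D\<close>. The powers of \<open>x_D\<close>, however,
  are pairwise distinct already in the rational function field.\<close>

lemma x_D_transcendental:
  assumes n: "n \<ge> 1" and A: "A \<in> F2pow_poly n" "poly A x_D = 0"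
  shows "A = 0"
proof (rule ccontr)
  assume A0: "A \<noteq> 0"
  define D where "D = Polynomial.degree A"
  define S where "S = {B \<in> F2pow_poly n. \<forall>i\<ge>D. poly.coeff B i = 0}"
  have "D \<noteq> 0"
  proof
    assume "D = 0"
    then obtain a where "A = [:a:]" unfolding D_def by (auto elim: degree_eq_zeroE)
    thus False using A A0 by simp
  qed
  have "S \<subseteq> Poly ` {xs. set xs \<subseteq> F2pow n \<and> length xs = D}"
  proof
    fix B assume B: "B \<in> S"
    have "B = Poly (map (poly.coeff B) [0..<D])"
      using B by (intro poly_eqI) (auto simp: S_def nth_default_def)
    thus "B \<in> Poly ` {xs. set xs \<subseteq> F2pow n \<and> length xs = D}"
      by (rule image_eqI) (use B in \<open>auto simp: S_def F2pow_poly_def\<close>)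
  qed
  hence finS: "finite S"
    by (rule finite_subset) (use n in \<open>intro finite_imageI finite_lists_length_eq finite_F2pow, simp\<close>)
  have "x_D ^ i \<in> (\<lambda>B. poly B x_D) ` S" for i
  proof (induction i)
    case 0
    have "1 \<in> S" using \<open>D \<noteq> 0\<close> by (auto simp: S_def one_pCons F2pow_poly_const coeff_pCons split: nat.splits)
    thus ?case by force
  next
    case (Suc i)
    then obtain B where B: "B \<in> S" "x_D ^ i = poly B x_D" by blast
    \<comment> \<open>One step of reduction modulo \<open>A\<close>: the multiple of
      \<open>A\<close> that cancels the coefficient at \<open>D\<close>.\<close>
    define a where "a = poly.coeff (pCons 0 B) D * inverse (poly.coeff A D)"
    define C where "C = pCons 0 B + Polynomial.smult a A"
    have a: "a \<in> F2pow n"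
      unfolding a_def using B A
      by (intro F2pow_mult F2pow_inverse) (auto simp: S_def F2pow_poly_def coeff_pCons split: nat.splits)
    have "C \<in> F2pow_poly n"
      unfolding C_def using B A a by (intro F2pow_poly_add F2pow_poly_smult) (auto simp: S_def F2pow_poly_pCons)
    moreover have "poly.coeff C j = 0" if "j \<ge> D" for j
    proof (cases "j = D")
      case True
      have "poly.coeff A D \<noteq> 0" using A0 by (simp add: D_def)
      thus ?thesis by (simp add: C_def True a_def mult.assoc)
    next
      case False
      hence "poly.coeff A j = 0" using that by (intro coeff_eq_0) (simp add: D_def)
      moreover have "poly.coeff (pCons 0 B) j = 0"
        using B(1) False that by (cases j) (auto simp: S_def)
      ultimately show ?thesis by (simp add: C_def)
    qed
    ultimately have "C \<in> S" by (simp add: S_def)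
    moreover have "poly C x_D = x_D ^ Suc i" using A(2) B(2) by (simp add: C_def)
    ultimately show ?case by (metis image_eqI)
  qed
  hence "range (\<lambda>i::nat. x_D ^ i) \<subseteq> (\<lambda>B. poly B x_D) ` S" by blast
  hence "finite (range (\<lambda>i::nat. x_D ^ i))" using finS finite_surj by blast
  moreover have "inj (\<lambda>i::nat. x_D ^ i)"
  proof (rule injI)
    fix i j :: nat assume ij: "x_D ^ i = x_D ^ j"
    have pow: "Fract [:0, 1 :: bit:] 1 ^ l = Fract ([:0, 1:] ^ l) 1" for l :: nat
      by (induction l) (simp_all add: One_fract_def)
    have "x_D ^ l = to_ac (Fract ([:0, 1 :: bit:] ^ l) 1)" for l
      unfolding x_D_def pow[symmetric] by (rule to_ac_power[symmetric])
    hence "Fract ([:0, 1 :: bit:] ^ i) 1 = Fract ([:0, 1:] ^ j) 1"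
      using ij by (simp only: to_ac_eq_iff)
    hence "[:0, 1 :: bit:] ^ i = [:0, 1:] ^ j" by (simp add: eq_fract)
    hence "Polynomial.degree ([:0, 1 :: bit:] ^ i) = Polynomial.degree ([:0, 1 :: bit:] ^ j)" by simp
    thus "i = j" by (simp add: degree_power_eq)
  qed
  ultimately show False using finite_imageD by blast
qed

lemma x_D_nonzero: "x_D \<noteq> 0"
  by (simp add: x_D_def Zero_fract_def eq_fract)

lemma inverse_x_D_transcendental:
  assumes "n \<ge> 1" "A \<in> F2pow_poly n" "poly A (inverse x_D) = 0"
  shows "A = 0"
proof -
  have "poly (reflect_poly A) x_D = 0"
    using poly_reflect_poly_nz[of x_D A] assms(3) x_D_nonzero by simp
  moreover have "reflect_poly A \<in> F2pow_poly n"
    using assms(2) by (simp add: F2pow_poly_def coeff_reflect_poly)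
  ultimately have "reflect_poly A = 0" using x_D_transcendental[OF assms(1)] by blast
  thus ?thesis by simp
qed

lemma card_points_D:
  assumes k: "k \<ge> 1" and n: "n \<ge> 1"
  shows "int (card (points_D k n)) = 2 ^ n + 1 + G k n"
proof -
  define M where "M = (2::nat) ^ (k - 1)"
  have M: "2 ^ k = 2 * M" "M \<ge> 1" using k by (simp_all add: M_def flip: power_Suc)
  define f where "f = (\<lambda>u. u ^ (2 ^ k + 1) + inverse u :: ambient)"
  let ?x = x_D and ?y = "y_D k"
  have x0: "?x \<noteq> 0" by (rule x_D_nonzero)
  have y: "?y ^ 2 + ?y = ?x ^ (2 ^ k + 1) + inverse ?x" by (rule y_D_eq)
  \<comment> \<open>Multiplication of the defining equation by \<open>x^2\<close> absorbs the pole
    at \<open>x = 0\<close>: \<open>x^2 (y^2 + y) = x + x^(2^k+3)\<close>.\<close>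
  interpret A: curve n 1 "2 ^ k + 2" ?x "?x * ?y"
  proof
    have "(?x * ?y) ^ 2 + ?x ^ 1 * (?x * ?y) = ?x ^ 2 * (?y ^ 2 + ?y)"
      by (simp add: power2_eq_square algebra_simps)
    also have "\<dots> = ?x + ?x ^ (2 ^ k + 2 + 1)"
      unfolding y using x0 by (simp add: power2_eq_square algebra_simps power_add)
    finally show "(?x * ?y) ^ 2 + ?x ^ 1 * (?x * ?y) = ?x + ?x ^ (2 ^ k + 2 + 1)" .
  qed (use x_D_transcendental[OF n] in auto)
  \<comment> \<open>With \<open>z = 1/x\<close>, \<open>M + 1\<close> is the least exponent for
    which the factor \<open>z^(2M+2)\<close> clears the pole of order
    \<open>2M + 1 = 2^k + 1\<close>. As this order is odd, a linear term is left: the right-hand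
    side becomes \<open>z + z^(2^k+3)\<close>.\<close>
  interpret B: curve n "M + 1" "2 ^ k + 2" "inverse ?x" "inverse ?x ^ (M + 1) * ?y"
  proof
    define z where "z = inverse ?x"
    have z: "z * ?x = 1" using x0 by (simp add: z_def)
    have "(z ^ (M + 1) * ?y) ^ 2 + z ^ (M + 1) * (z ^ (M + 1) * ?y) = z ^ (2 * M + 2) * (?y ^ 2 + ?y)"
    proof -
      have "z ^ (2 * M + 2) = z ^ (M + 1) * z ^ (M + 1)" by (simp add: mult_2 flip: power_add)
      thus ?thesis by (simp only: power2_eq_square distrib_left mult_ac)
    qed
    also have "\<dots> = z * (z * ?x) ^ (2 * M + 1) + z ^ (2 * M + 2) * z"
      unfolding y M z_def[symmetric] by (simp add: distrib_left power_add power_mult_distrib)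
    also have "\<dots> = z + z ^ (2 ^ k + 2 + 1)" by (simp add: z M power_add)
    finally show "(inverse ?x ^ (M + 1) * ?y) ^ 2 + inverse ?x ^ (M + 1) * (inverse ?x ^ (M + 1) * ?y) =
        inverse ?x + inverse ?x ^ (2 ^ k + 2 + 1)" by (simp only: z_def)
  qed (use inverse_x_D_transcendental[OF n] in auto)
  let ?K = "function_field_D k n" and ?F = "F2pow n"
  have K: "?K = generate_field ambient_ring (?F \<union> {?x, ?y})" by (simp add: function_field_D_def)
  note E = generate_field_closed[where H = "?F \<union> {?x, ?y}"]
  have xE: "?x \<in> generate_field ambient_ring (?F \<union> {?x, ?y})" "?y \<in> generate_field ambient_ring (?F \<union> {?x, ?y})"
    using E(3) by auto
  have zE: "inverse ?x ^ i \<in> generate_field ambient_ring (?F \<union> {?x, ?y})" for i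
    by (induction i) (use E(2,5,6) xE in auto)
  have AK: "A.K = ?K"
    unfolding K
  proof (rule A.K_eq_generate_field)
    have one: "1 \<in> A.R" using A.const_R[of 1] by simp
    have "?x / 1 \<in> A.K" "(?x * ?y) / ?x \<in> A.K"
      unfolding A.K_def using A.s_R A.w_R one x0 one_neq_zero by blast+
    moreover have "?x / 1 = ?x" "(?x * ?y) / ?x = ?y" using x0 by simp_all
    ultimately show "{?x, ?y} \<subseteq> A.K" by (simp only: insert_subset empty_subsetI simp_thms)
  qed (use xE E(5) in auto)
  have BK: "B.K = ?K"
    unfolding K
  proof (rule B.K_eq_generate_field)
    let ?z = "inverse ?x"
    have z0: "?z \<noteq> 0" using x0 by simp
    have one: "1 \<in> B.R" using B.const_R[of 1] by simp
    have pow: "?z ^ i \<in> B.R" for i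
    proof (induction i)
      case (Suc i)
      show ?case unfolding power_Suc by (rule B.R_mult[OF B.s_R Suc])
    qed (use one in \<open>simp only: power_0\<close>)
    have pow0: "?z ^ (M + 1) \<noteq> 0" using z0 by simp
    have "1 / ?z \<in> B.K" "(?z ^ (M + 1) * ?y) / ?z ^ (M + 1) \<in> B.K"
      unfolding B.K_def using B.s_R B.w_R one pow z0 pow0 by blast+
    moreover have "1 / ?z = ?x" by (simp only: divide_inverse inverse_inverse_eq mult_1_left)
    moreover have "(?z ^ (M + 1) * ?y) / ?z ^ (M + 1) = ?y"
      by (rule nonzero_mult_div_cancel_left[OF pow0])
    ultimately show "{?x, ?y} \<subseteq> B.K" by (simp only: insert_subset empty_subsetI simp_thms)
  qed (use xE zE[of 1] zE[of "M + 1"] E(5) in auto)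
  define P where "P = rational_places ?F ?K"
  have split: "P = {V \<in> P. ?x \<in> V} \<union> {V \<in> P. inverse ?x \<in> maximal_ideal_of V}"
    and disj: "{V \<in> P. ?x \<in> V} \<inter> {V \<in> P. inverse ?x \<in> maximal_ideal_of V} = {}"
  proof -
    have "inverse ?x \<in> maximal_ideal_of V \<longleftrightarrow> ?x \<notin> V" if "V \<in> P" for V
    proof -
      have "?x \<in> ?K" using xE by (simp add: K)
      hence "?x \<in> V \<or> inverse ?x \<in> V"
        using that by (auto simp: P_def rational_places_def valuation_ring_def)
      thus ?thesis using x0 by (auto simp: maximal_ideal_of_def)
    qed
    thus "P = {V \<in> P. ?x \<in> V} \<union> {V \<in> P. inverse ?x \<in> maximal_ideal_of V}"
      "{V \<in> P. ?x \<in> V} \<inter> {V \<in> P. inverse ?x \<in> maximal_ideal_of V} = {}" by auto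
  qed
  obtain V\<^sub>0 where inf: "{V \<in> P. inverse ?x \<in> maximal_ideal_of V} = {V\<^sub>0}"
    using B.ex1_place_over_0 unfolding P_def BK by blast
  have finF: "finite ?F" using n by (intro finite_F2pow) auto
  define S where "S = A.affine_points"
  have mem_S: "(c, d) \<in> S \<longleftrightarrow> c \<in> ?F \<and> d \<in> ?F \<and> d ^ 2 + c * d = c + c ^ (2 ^ k + 3)" for c d
    unfolding S_def A.affine_points_def by (simp add: numeral_3_eq_3)
  have finS: "finite S"
    by (rule finite_subset[of _ "?F \<times> ?F"]) (use finF mem_S in auto)
  have bij_S: "bij_betw (\<lambda>p. THE V. V \<in> P \<and> A.centered V (fst p) (snd p)) S {V \<in> P. ?x \<in> V}"
    using A.card_places_affine unfolding AK S_def P_def .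
  have "finite {V \<in> P. ?x \<in> V}"
    using bij_betw_finite[OF bij_S] finS by blast
  hence "card P = card S + 1"
    by (subst split, subst card_Un_disjoint) (use disj inf finS bij_betw_same_card[OF bij_S] in auto)
  moreover have "int (card S) = 2 ^ n + G k n"
  proof -
    \<comment> \<open>Over nonzero \<open>c\<close> the substitution \<open>d = c * b\<close> leads
      back to the Artin-Schreier equation; the remaining point is the one over the pole
      \<open>x = 0\<close> of \<open>1/x\<close>.\<close>
    have pts: "S = insert (0, 0) ((\<lambda>(c, b). (c, c * b)) ` (SIGMA c:?F - {0}. {b \<in> ?F. b ^ 2 + b = f c}))"
    proof (intro equalityI subsetI)
      fix p assume pS: "p \<in> S"
      obtain c d where cd: "p = (c, d)" by (cases p)
      have p: "p = (c, d)" "c \<in> ?F" "d \<in> ?F" "d ^ 2 + c * d = c + c ^ (2 ^ k + 3)"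
        using pS mem_S unfolding cd by blast+
      show "p \<in> insert (0, 0) ((\<lambda>(c, b). (c, c * b)) ` (SIGMA c:?F - {0}. {b \<in> ?F. b ^ 2 + b = f c}))"
      proof (cases "c = 0")
        case True
        hence "d = 0" using p(4) by (simp add: power_0_left)
        thus ?thesis using p True by simp
      next
        case False
        define b where "b = d * inverse c"
        have d: "d = c * b" using False by (simp add: b_def)
        have "c ^ 2 * (b ^ 2 + b) = d ^ 2 + c * d" by (simp add: d power2_eq_square algebra_simps)
        also have "\<dots> = c ^ 2 * f c"
          unfolding p(4) f_def using False by (simp add: algebra_simps power_add eval_nat_numeral)
        finally have "b ^ 2 + b = f c" using False by simp
        moreover have "b \<in> ?F" unfolding b_def by (intro F2pow_mult F2pow_inverse p)
        ultimately show ?thesis using p d False by (auto intro!: image_eqI[of _ _ "(c, b)"])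
      qed
    next
      fix p assume "p \<in> insert (0, 0) ((\<lambda>(c, b). (c, c * b)) ` (SIGMA c:?F - {0}. {b \<in> ?F. b ^ 2 + b = f c}))"
      then consider "p = (0, 0)" | c b where "p = (c, c * b)" "c \<in> ?F" "c \<noteq> 0" "b \<in> ?F" "b ^ 2 + b = f c"
        by auto
      thus "p \<in> S"
      proof cases
        case 2
        have "(c * b) ^ 2 + c * (c * b) = c ^ 2 * (b ^ 2 + b)"
          by (simp add: power2_eq_square algebra_simps)
        also have "\<dots> = c + c ^ (2 ^ k + 3)"
          unfolding 2(5) f_def using 2(3) by (simp add: algebra_simps power_add eval_nat_numeral)
        finally show ?thesis using 2 by (simp add: mem_S F2pow_mult)
      qed (simp add: mem_S)
    qed
    have "card S = 1 + card (SIGMA c:?F - {0}. {b \<in> ?F. b ^ 2 + b = f c})"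
    proof -
      have "inj_on (\<lambda>(c, b). (c, c * b)) (SIGMA c:?F - {0}. {b \<in> ?F. b ^ 2 + b = f c})"
        by (auto simp: inj_on_def)
      moreover have "(0, 0) \<notin> (\<lambda>(c, b). (c, c * b)) ` (SIGMA c:?F - {0}. {b \<in> ?F. b ^ 2 + b = f c})"
        by auto
      ultimately show ?thesis unfolding pts using finF
        by (subst card_insert_disjoint) (auto simp: card_image intro!: finite_imageI finite_SigmaI)
    qed
    also have "card (SIGMA c:?F - {0}. {b \<in> ?F. b ^ 2 + b = f c}) =
        (\<Sum>c\<in>?F - {0}. if trace2 n (f c) = 0 then 2 else 0)"
    proof (subst card_SigmaI)
      show "(\<Sum>c\<in>?F - {0}. card {b \<in> ?F. b ^ 2 + b = f c}) = (\<Sum>c\<in>?F - {0}. if trace2 n (f c) = 0 then 2 else 0)"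
        by (intro sum.cong refl card_artin_schreier n)
           (auto simp: f_def intro!: F2pow_add F2pow_inverse F2pow_mult F2pow_power)
    qed (use finF in auto)
    \<comment> \<open>The fibre sizes 2 and 0 are \<open>1 + 1\<close> and \<open>1 - 1\<close>, the
      second term being the sign in \<open>G\<close>.\<close>
    also have "int (1 + (\<Sum>c\<in>?F - {0}. if trace2 n (f c) = 0 then 2 else 0)) =
        1 + (\<Sum>c\<in>?F - {0}. 1 + (if trace2 n (f c) = 0 then 1 else -1))"
      unfolding of_nat_add of_nat_sum by (intro arg_cong2[of _ _ _ _ "(+)"] sum.cong) auto
    also have "\<dots> = 1 + (int (card (?F - {0})) + G k n)"
      by (simp add: sum.distrib G_def f_def)
    also have "card (?F - {0}) = 2 ^ n - 1"
      using finF n by (simp add: card_Diff_singleton card_F2pow)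
    also have "1 + (int (2 ^ n - 1) + G k n) = 2 ^ n + G k n" by (simp add: of_nat_diff)
    finally show ?thesis .
  qed
  ultimately show ?thesis by (simp add: points_D_def P_def)
qed

section \<open>The L-polynomial\<close>

definition L_poly :: "nat \<Rightarrow> int poly" where
  "L_poly k = (\<Sum>d<2 ^ k + 3. Polynomial.monom (chi_sum k d) d)"

lemma coeff_L_poly: "poly.coeff (L_poly k) d = chi_sum k d"
proof -
  have "poly.coeff (L_poly k) d = (if d < 2 ^ k + 3 then chi_sum k d else 0)"
    by (simp add: L_poly_def coeff_sum)
  thus ?thesis using chi_sum_vanish[of k d] by auto
qed

text \<open>Polymorphic because the comparison with the zeta function takes place over
  \<open>rat\<close> and the division of L-polynomials over \<open>int\<close>.\<close>

definition chi_fps :: "nat \<Rightarrow> 'a :: comm_ring_1 fps" where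
  "chi_fps k = Abs_fps (\<lambda>d. of_int (chi_sum k d))"

text \<open>The index is shifted by one, so that this is the logarithmic derivative itself.\<close>

definition G_fps :: "nat \<Rightarrow> 'a :: comm_ring_1 fps" where
  "G_fps k = Abs_fps (\<lambda>n. of_int (G k (Suc n)))"

lemma chi_fps_deriv: "fps_deriv (chi_fps k) = chi_fps k * G_fps k"
proof (rule fps_ext)
  fix n
  have "(of_nat (Suc n) * of_int (chi_sum k (Suc n)) :: 'a) = of_int (int (Suc n) * chi_sum k (Suc n))"
    by simp
  also have "int (Suc n) * chi_sum k (Suc n) = (\<Sum>i=1..Suc n. G k i * chi_sum k (Suc n - i))"
    by (rule chi_sum_recurrence)
  also have "\<dots> = (\<Sum>i=0..n. chi_sum k i * G k (Suc (n - i)))"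
    by (rule sum.reindex_bij_witness[where i = "\<lambda>i. Suc n - i" and j = "\<lambda>i. Suc n - i"])
       (auto simp: mult.commute Suc_diff_le)
  finally show "fps_nth (fps_deriv (chi_fps k)) n = fps_nth (chi_fps k * G_fps k :: 'a fps) n"
    by (simp add: chi_fps_def G_fps_def fps_mult_nth del: of_nat_Suc)
qed

lemma fps_log_deriv_unique:
  fixes A B :: "'a :: field_char_0 fps"
  assumes "fps_deriv A = A * g" "fps_deriv B = B * g" "fps_nth A 0 = fps_nth B 0"
  shows "A = B"
proof (rule fps_ext)
  fix n show "fps_nth A n = fps_nth B n"
  proof (induction n rule: less_induct)
    case (less n)
    show ?case
    proof (cases n)
      case (Suc m)
      have "of_nat (Suc m) * fps_nth A (Suc m) = (\<Sum>i=0..m. fps_nth A i * fps_nth g (m - i))"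
        using arg_cong[OF assms(1), of "\<lambda>f. fps_nth f m"] by (simp add: fps_mult_nth)
      also have "\<dots> = (\<Sum>i=0..m. fps_nth B i * fps_nth g (m - i))"
        using less Suc by (intro sum.cong refl) auto
      also have "\<dots> = of_nat (Suc m) * fps_nth B (Suc m)"
        using arg_cong[OF assms(2), of "\<lambda>f. fps_nth f m"] by (simp add: fps_mult_nth)
      finally show ?thesis using Suc by (simp del: of_nat_Suc)
    qed (use assms in simp)
  qed
qed

text \<open>Logarithms are avoided: the zeta function times \<open>(1 - X) * (1 - 2 X)\<close> and
  \<open>chi_fps k\<close> have the same constant term and both satisfy
  \<open>f' = f * G_fps k\<close>, which fixes a power series in characteristic zero.\<close>

lemma is_L_polynomial_L_poly:
  assumes k: "k \<ge> 1"
  shows "is_L_polynomial k (L_poly k)"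
proof -
  define N where "N = (\<lambda>n. card (points_D k n))"
  define S :: "rat fps" where "S = Abs_fps (\<lambda>n. if n = 0 then 0 else of_nat (N n) / of_nat n)"
  define Z where "Z = fps_exp 1 oo S"
  define a b :: "rat fps" where "a = 1 - fps_X" and "b = 1 - 2 * fps_X"
  \<comment> \<open>\<open>P\<close> and \<open>2 * Q\<close> are the shares of the terms 1 and
    \<open>2 ^ n\<close> of the point count in the derivative of \<open>S\<close>. As
    \<open>P\<close> and \<open>Q\<close> are the inverses of \<open>a\<close> and \<open>b\<close>,
    these shares cancel against the derivatives of the two factors.\<close>
  define P Q :: "rat fps" where "P = Abs_fps (\<lambda>n. 1)" and "Q = Abs_fps (\<lambda>n. 2 ^ n)"
  have aP: "a * P = 1"
  proof (rule fps_ext)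
    fix n show "fps_nth (a * P) n = fps_nth 1 n"
      by (cases n) (simp_all add: a_def P_def left_diff_distrib)
  qed
  have bQ: "b * Q = 1"
  proof (rule fps_ext)
    fix n show "fps_nth (b * Q) n = fps_nth 1 n"
      by (cases n) (simp_all add: b_def Q_def left_diff_distrib mult.assoc numeral_fps_const)
  qed
  have S0: "fps_nth S 0 = 0" by (simp add: S_def)
  have "fps_deriv S = P + 2 * Q + G_fps k"
  proof (rule fps_ext)
    fix n
    have "(of_nat (N (Suc n)) :: rat) = of_int (int (N (Suc n)))" by simp
    also have "int (N (Suc n)) = 2 ^ Suc n + 1 + G k (Suc n)"
      unfolding N_def by (rule card_points_D) (use k in simp_all)
    finally show "fps_nth (fps_deriv S) n = fps_nth (P + 2 * Q + G_fps k) n"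
      by (simp add: S_def P_def Q_def G_fps_def numeral_fps_const del: of_nat_Suc)
  qed
  moreover have "fps_deriv Z = Z * fps_deriv S"
    unfolding Z_def by (subst fps_compose_deriv[OF S0]) simp
  ultimately have dZ: "fps_deriv Z = Z * (P + 2 * Q + G_fps k)" by simp
  have "fps_deriv (Z * (a * b)) = Z * (a * b) * G_fps k"
  proof -
    have da: "fps_deriv a = - 1" and db: "fps_deriv b = - 2"
      by (simp_all add: a_def b_def fps_deriv_mult numeral_fps_const)
    have "fps_deriv (Z * (a * b)) = Z * (P + 2 * Q + G_fps k) * (a * b) + Z * (a * (-2) + (-1) * b)"
      by (simp add: dZ da db)
    also have "\<dots> = Z * (a * b) * G_fps k + Z * ((a * P) * b - b) + 2 * Z * (a * (b * Q) - a)"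
      by (simp add: algebra_simps)
    finally show ?thesis by (simp add: aP bQ)
  qed
  hence "Z * (a * b) = chi_fps k"
    by (rule fps_log_deriv_unique[OF _ chi_fps_deriv])
       (simp add: Z_def a_def b_def chi_fps_def chi_sum_0)
  moreover have "chi_fps k = fps_of_poly (map_poly rat_of_int (L_poly k))"
    by (rule fps_ext) (simp add: chi_fps_def coeff_map_poly coeff_L_poly)
  moreover have "a * b \<noteq> 0" using aP bQ by auto
  ultimately have "Z = fps_of_poly (map_poly rat_of_int (L_poly k)) / (a * b)"
    by (metis nonzero_mult_div_cancel_right)
  thus ?thesis
    by (simp add: is_L_polynomial_def zeta_fps_def Z_def S_def N_def a_def b_def cong: if_cong)
qed

lemma L_D_eq: "k \<ge> 1 \<Longrightarrow> L_D k = L_poly k"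
  by (rule L_D_eqI[OF is_L_polynomial_L_poly])

lemma L_poly_1: "L_poly 1 = [:1, 1, 0, 2, 4:]"
proof (rule poly_eqI)
  fix d :: nat
  consider "d = 0" | "d = 1" | "d = 2" | "d = 3" | "d = 4" | "d \<ge> 5" by linarith
  thus "poly.coeff (L_poly 1) d = poly.coeff [:1, 1, 0, 2, 4:] d"
  proof cases
    case 6
    hence "poly.coeff [:1, 1, 0, 2, 4 :: int:] d = 0" by (intro coeff_eq_0) simp
    thus ?thesis using 6 using chi_sum_vanish[of 1 d] by (simp add: coeff_L_poly)
  qed (simp_all only: coeff_L_poly chi_sum_0 chi_sum_1_1 chi_sum_1_2 chi_sum_1_3 chi_sum_1_4,
       simp_all add: numeral_eq_Suc)
qed

section \<open>The quotient of the two L-polynomials\<close>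

theorem theorem21:
  fixes k p a :: nat
  assumes G_eq: "\<And>k' m :: nat. k' \<ge> 1 \<Longrightarrow> m \<ge> 1 \<Longrightarrow> coprime k' m \<Longrightarrow> G k' m = G 1 m"
    and p: "prime p" and a: "a \<ge> 1" and k: "k = p ^ a"
  shows "\<exists>Q :: int poly. L_D k = pcompose Q (Polynomial.monom 1 p) * L_D 1"
proof -
  have p2: "p \<ge> 2" using p by (rule prime_ge_2_nat)
  define A B :: "int fps" where "A = chi_fps 1" and "B = chi_fps k"
  have A: "A = fps_of_poly (L_poly 1)" and B: "B = fps_of_poly (L_poly k)"
    by (rule fps_ext, simp add: A_def B_def chi_fps_def coeff_L_poly)+
  \<comment> \<open>The integers are no field, but the constant term of \<open>A\<close> is 1, so
    the quotient exists with integer coefficients; this makes \<open>Q\<close> integral.\<close>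
  define R where "R = B * fps_right_inverse A 1"
  have "A * fps_right_inverse A 1 = 1"
    by (rule fps_right_inverse) (simp add: A_def chi_fps_def chi_sum_0)
  hence AR: "A * R = B" by (simp add: R_def mult.left_commute)
  have A0: "A \<noteq> 0" by (simp add: A L_poly_1[unfolded One_nat_def])
  define r where "r = fps_nth R"
  have dR: "fps_deriv R = R * (G_fps k - G_fps 1)"
  proof -
    have "A * fps_deriv R + A * G_fps 1 * R = A * R * G_fps k"
      using arg_cong[OF AR, of fps_deriv] chi_fps_deriv[of 1, where 'a = int] chi_fps_deriv[of k, where 'a = int] AR
      by (simp add: A_def B_def mult_ac add_ac)
    hence "A * (fps_deriv R - R * (G_fps k - G_fps 1)) = 0"
      by (simp add: algebra_simps)
    thus ?thesis using A0 by simp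
  qed
  have G_zero: "G k n = G 1 n" if "\<not> p dvd n" for n
  proof -
    \<comment> \<open>The prime power enters here: \<open>k\<close> has no prime divisor other than
      \<open>p\<close>.\<close>
    have "coprime k n" using p that k
      by (simp add: prime_imp_coprime coprime_power_left_iff)
    moreover have "n \<ge> 1" using that by (cases n) auto
    moreover have "k \<ge> 1" using k p2 by simp
    ultimately show ?thesis by (intro G_eq)
  qed
  have r_zero: "r n = 0" if "\<not> p dvd n" for n
    using that
  proof (induction n rule: less_induct)
    case (less n)
    then obtain m where m: "n = Suc m" by (cases n) auto
    have "int n * r n = (\<Sum>i=0..m. r i * (G k (Suc (m - i)) - G 1 (Suc (m - i))))"
      using arg_cong[OF dR, of "\<lambda>f. fps_nth f m"]
      by (simp add: r_def m fps_mult_nth G_fps_def)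
    also have "\<dots> = 0"
    proof (intro sum.neutral ballI)
      fix i assume i: "i \<in> {0..m}"
      have "i + Suc (m - i) = n" using i m by simp
      \<comment> \<open>If \<open>p\<close> does not divide \<open>i\<close>, then
        \<open>r i\<close> vanishes by induction; otherwise the two values of \<open>G\<close>
        agree.\<close>
      hence "\<not> p dvd i \<or> \<not> p dvd Suc (m - i)" using less.prems by (metis dvd_add)
      thus "r i * (G k (Suc (m - i)) - G 1 (Suc (m - i))) = 0"
        using less.IH[of i] G_zero i m by auto
    qed
    finally show ?case using m by simp
  qed
  \<comment> \<open>The coefficient at \<open>n + 4\<close> in \<open>A * R = B\<close>, with the
    coefficients 1, 1, 0, 2, 4 of \<open>A\<close>; beyond degree \<open>2 ^ k + 2\<close> those of
    \<open>B\<close> vanish.\<close>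
  have rec: "r (n + 4) + r (n + 3) + 2 * r (n + 1) + 4 * r n = 0" if "n \<ge> 2 ^ k" for n
  proof -
    have "A = 1 + fps_X * (1 + fps_X * (fps_X * (2 + fps_X * 4)))"
      by (simp add: A L_poly_1[unfolded One_nat_def] fps_of_poly_pCons numeral_fps_const mult.commute)
    hence "A * R = R + fps_X * (R + fps_X * (fps_X * (2 * R + fps_X * (4 * R))))"
      by (simp add: algebra_simps)
    hence "fps_nth B (n + 4) = r (n + 4) + r (n + 3) + 2 * r (n + 1) + 4 * r n"
      by (simp add: AR r_def numeral_fps_const eval_nat_numeral)
    moreover have "fps_nth B (n + 4) = 0" using that by (simp add: B_def chi_fps_def chi_sum_vanish)
    ultimately show ?thesis by simp
  qed
  have r_end: "r n = 0" if n: "n \<ge> 2 ^ k" for n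
  proof (cases "p dvd n")
    case dvd: True
    have nd: "\<not> p dvd n + i" if "\<not> p dvd i" for i
      using dvd that by (simp add: dvd_add_right_iff)
    have rec0: "r (n + 4) + r (n + 3) + 2 * r (n + 1) + 4 * r n = 0"
      and rec1: "r (n + 5) + r (n + 4) + 2 * r (n + 2) + 4 * r (n + 1) = 0"
      and rec2: "r (n + 6) + r (n + 5) + 2 * r (n + 3) + 4 * r (n + 2) = 0"
      and rec3: "r (n + 7) + r (n + 6) + 2 * r (n + 4) + 4 * r (n + 3) = 0"
      using rec[of n] rec[of "n + 1"] rec[of "n + 2"] rec[of "n + 3"] n
      by (simp_all add: eval_nat_numeral)
    consider "p = 2" | "p = 3" | "p \<ge> 5"
    proof -
      have "p \<noteq> 4" using p by (auto simp: prime_nat_iff dest!: spec[of _ "2::nat"])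
      thus ?thesis using p2 that by linarith
    qed
    thus ?thesis
    proof cases
      case 1
      \<comment> \<open>Now \<open>rec2\<close> gives \<open>r (n + 6) = - 4 * r (n + 2)\<close>,
        while \<open>rec3\<close> and \<open>rec1\<close> give
        \<open>r (n + 6) = - 2 * r (n + 4) = 4 * r (n + 2)\<close>. So all of these vanish, and
        \<open>rec0\<close> leaves \<open>r n = 0\<close>.\<close>
      have "r (n + 1) = 0" "r (n + 3) = 0" "r (n + 5) = 0" "r (n + 7) = 0"
        by (intro r_zero nd; use 1 in simp)+
      thus ?thesis using rec0 rec1 rec2 rec3 by linarith
    next
      case 2
      \<comment> \<open>Now \<open>rec2\<close> and \<open>rec3\<close> give
        \<open>r (n + 6) = - 2 * r (n + 3) = - 4 * r (n + 3)\<close>, so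
        \<open>r (n + 3) = 0\<close>, and \<open>rec0\<close> leaves \<open>r n = 0\<close>.\<close>
      have "r (n + 1) = 0" "r (n + 4) = 0" "r (n + 2) = 0" "r (n + 5) = 0" "r (n + 7) = 0"
        by (intro r_zero nd; use 2 in simp)+
      thus ?thesis using rec0 rec1 rec2 rec3 by linarith
    next
      case 3
      \<comment> \<open>No offset 1, 3, 4 is a multiple of a prime \<open>p \<ge> 5\<close>, so
        \<open>rec0\<close> is \<open>4 * r n = 0\<close>.\<close>
      have "r (n + 1) = 0" "r (n + 3) = 0" "r (n + 4) = 0"
        by (intro r_zero nd; use 3 in \<open>auto dest: dvd_imp_le\<close>)+
      thus ?thesis using rec0 by linarith
    qed
  qed (rule r_zero)
  \<comment> \<open>The cut at \<open>2 ^ k\<close> loses nothing: for larger \<open>j\<close> also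
    \<open>p * j \<ge> 2 ^ k\<close>, where \<open>r\<close> vanishes.\<close>
  define Q where "Q = (\<Sum>j<2 ^ k. Polynomial.monom (r (p * j)) j)"
  have coeff_Q: "poly.coeff Q j = r (p * j)" for j
  proof -
    have "poly.coeff Q j = (if j < 2 ^ k then r (p * j) else 0)"
      by (simp add: Q_def coeff_sum)
    moreover have "r (p * j) = 0" if "\<not> j < 2 ^ k"
    proof (rule r_end)
      have "j \<le> p * j" using p2 by simp
      thus "2 ^ k \<le> p * j" using that by linarith
    qed
    ultimately show ?thesis by auto
  qed
  have "fps_of_poly (pcompose Q (Polynomial.monom 1 p)) = fps_of_poly Q oo fps_X ^ p"
    using p2 by (subst fps_of_poly_pcompose) (auto simp: fps_of_poly_monom)
  also have "\<dots> = R"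
    using p2 r_zero by (intro fps_ext) (auto simp: fps_nth_compose_X_power coeff_Q r_def)
  finally have "fps_of_poly (pcompose Q (Polynomial.monom 1 p) * L_poly 1) = fps_of_poly (L_poly k)"
    using AR by (simp add: fps_of_poly_mult A B mult.commute)
  hence "L_poly k = pcompose Q (Polynomial.monom 1 p) * L_poly 1" by simp
  moreover have "k \<ge> 1" using k p2 by simp
  ultimately show ?thesis using L_D_eq[of k] L_D_eq[of 1] by auto
qed

end
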